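(* Let $r,s\ge1$, and let $L_1,\dots,L_k\subset\{0,1\}^r\setminus\{0_r\}$ and $R_1,\dots,R_k\subset\{0,1\}^s\setminus\{0_s\}$ be two collections of nonempty sets such that the sets $L_i\times R_i$ are pairwise disjoint and form a partition of $(\{0,1\}^r\setminus\{0_r\})\times(\{0,1\}^s\setminus\{0_s\})$. For a random vector $(X,Y)$ in $\mathbb{R}^r\times\mathbb{R}^s$ and $i\in\{1,\dots,k\}$ let $$\mu_i^{joint}(X,Y)=\int_{\mathbb{R}^{r+s}}A_i(x,y)^2\,\mathrm{d}F_{XY}(x,y),\qquad \mu_i^{prod}(X,Y)=\int_{\mathbb{R}^{r+s}}A_i(x,y)^2\prod_{a=1}^r\mathrm{d}F_{X_a}(x_a)\prod_{b=1}^s\mathrm{d}F_{Y_b}(y_b),$$ where $A_i(x,y)$ is the $2\times2$ block minor along $(\{0_r\},L_i,\{0_s\},R_i)$. Then $\mu^{joint}=\sum_{i=1}^k\mu_i^{joint}$ and $\mu^{prod}=\sum_{i=1}^k\mu_i^{prod}$ are Summed Symmetric Rank Covariances, and: (a) $\mu^{joint}$ is D-consistent in, at least, all cases that Hoeffding's $D$ is: for any class of joint distributions of $(X,Y)$ on which $D(X,Y)\neq0$ whenever $X,Y$ are dependent, also $\mu^{joint}(X,Y)\ne0$ whenever $X,Y$ are dependent. (b) $\mu^{prod}$ is D-consistent in all cases: for every $(X,Y)$ with $X$ and $Y$ dependent, $\mu^{prod}(X,Y)\ne0$.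
   Context: $F_{XY},F_X,F_Y,F_{X_a},F_{Y_b}$ are cumulative distribution functions; $0_d$ is the zero vector. Hoeffding's $D$ is $D(X,Y)=\int_{\mathbb{R}^{r+s}}(F_{XY}(x,y)-F_X(x)F_Y(y))^2\,\mathrm{d}F_{XY}(x,y)$. Block minors: for an $\mathbb{R}^d$-valued random vector $V$ and $v\in\mathbb{R}^d$, $B^V(v)=(1_{[V_1>v_1]},\dots,1_{[V_d>v_d]})$. For $z=(x,y)$ let $p(z)_{\ell_X\ell_Y}=P(B^X(x)=\ell_X,B^Y(y)=\ell_Y)$. The block minor along $(\{0_r\},L,\{0_s\},R)$ is $$p(z)_{0_r0_s}\sum_{\ell_X\in L,\,\ell_Y\in R}p(z)_{\ell_X\ell_Y}-\Big(\sum_{\ell_X\in L}p(z)_{\ell_X0_s}\Big)\Big(\sum_{\ell_Y\in R}p(z)_{0_r\ell_Y}\Big).$$ Symmetric Rank Covariances: $w^{[m]}=(w^1,\dots,w^m)\in\mathbb{R}^{d\times m}$, and for $\sigma\in S_m$, $w^{\sigma[m]}=(w^{\sigma^{-1}(1)},\dots,w^{\sigma^{-1}(m)})$. Joint rank matrix: $\mathcal{R}(w^{[m]})_{ij}=1+\sum_{k=1}^m1_{[w^k_i<w^j_i]}$. A rank indicator function of order $m$ and dimension $d$ is $I:\mathbb{R}^{d\times m}\to\{0,1\}$ with $I(\mathcal{R}(w^{[m]}))=I(w^{[m]})$. For rank indicator functions $I_X,I_Y$ of equal order $m$ and dimensions $r,s$, and a subgroup $H\le S_m$ with equally many even and odd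 permutations, with $(X^i,Y^i)$ i.i.d. copies of $(X,Y)$, $$\mu_{I_X,I_Y,H}(X,Y)=E\Big[\Big(\sum_{\sigma\in H}\mathrm{sign}(\sigma)I_X(X^{\sigma[m]})\Big)\Big(\sum_{\sigma\in H}\mathrm{sign}(\sigma)I_Y(Y^{\sigma[m]})\Big)\Big].$$ A Symmetric Rank Covariance is a measure of the form $c\,\mu_{I_X,I_Y,H}$ with $c>0$; a Summed Symmetric Rank Covariance is a sum of several (finitely many) Symmetric Rank Covariances. *)

theory Defs
  imports "HOL-Probability.Probability" "HOL-Algebra.Sym_Groups"
begin

text \<open>
  All functionals of a random vector \<open>(X, Y)\<close> considered here depend only on its joint law, so they
  are rendered as functionals on the Borel probability measures \<open>P\<close> on the product of two Euclidean
  spaces, with \<open>X = fst\<close> and \<open>Y = snd\<close> as the canonical random vector with law \<open>P\<close>.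
  The dimensions \<open>r\<close> and \<open>s\<close> are the cardinalities of the index types \<open>'r\<close> and \<open>'s\<close>; the order
  \<open>\<le>\<close> on vectors is the componentwise one.
\<close>

definition joint_laws :: "((real ^ 'r) \<times> (real ^ 's)) measure set" where
  "joint_laws = {P. prob_space P \<and> sets P = sets borel}"

text \<open>
  The library's \<open>indep_var\<close> needs both variables to have the same codomain type, which fails for
  \<open>real ^ 'r\<close> and \<open>real ^ 's\<close>; independence is hence stated for the generated \<open>\<sigma>\<close>-algebras.
\<close>

definition indep_vectors :: "'a measure \<Rightarrow> ('a \<Rightarrow> real ^ 'r) \<Rightarrow> ('a \<Rightarrow> real ^ 's) \<Rightarrow> bool" where
  "indep_vectors M X Y \<longleftrightarrow>
     prob_space.indep_set M {X -` A \<inter> space M | A. A \<in> sets borel} {Y -` B \<inter> space M | B. B \<in> sets borel}"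

definition dependent :: "((real ^ 'r) \<times> (real ^ 's)) measure \<Rightarrow> bool" where
  "dependent P \<longleftrightarrow> \<not> indep_vectors P fst snd"

definition D_consistent_on ::
  "((real ^ 'r) \<times> (real ^ 's)) measure set \<Rightarrow>
   (((real ^ 'r) \<times> (real ^ 's)) measure \<Rightarrow> real) \<Rightarrow> bool" where
  "D_consistent_on \<C> \<mu> \<longleftrightarrow> (\<forall>P\<in>\<C>. dependent P \<longrightarrow> \<mu> P \<noteq> 0)"

lemma indep_vectors_iff:
  assumes "prob_space M" "X \<in> borel_measurable M" "Y \<in> borel_measurable M"
  shows "indep_vectors M X Y \<longleftrightarrow> (\<forall>A\<in>sets borel. \<forall>B\<in>sets borel.
    measure M ((X -` A \<inter> space M) \<inter> (Y -` B \<inter> space M)) =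
    measure M (X -` A \<inter> space M) * measure M (Y -` B \<inter> space M))"
proof -
  interpret prob_space M by fact
  have *: "{X -` A \<inter> space M | A. A \<in> sets borel} = (\<lambda>A. X -` A \<inter> space M) ` sets borel"
    "{Y -` B \<inter> space M | B. B \<in> sets borel} = (\<lambda>B. Y -` B \<inter> space M) ` sets borel"
    by (rule Setcompr_eq_image)+
  have "(\<lambda>A. X -` A \<inter> space M) ` sets borel \<subseteq> sets M" "(\<lambda>B. Y -` B \<inter> space M) ` sets borel \<subseteq> sets M"
    using measurable_sets[OF assms(2)] measurable_sets[OF assms(3)] by blast+
  then show ?thesis
    unfolding indep_vectors_def * indep_sets2_eq by simp
qed

lemma joint_law_of_random_vector:
  fixes X :: "'a \<Rightarrow> real ^ 'r" and Y :: "'a \<Rightarrow> real ^ 's"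
  assumes "prob_space M" and [measurable]: "X \<in> borel_measurable M" "Y \<in> borel_measurable M"
  shows "distr M borel (\<lambda>\<omega>. (X \<omega>, Y \<omega>)) \<in> joint_laws"
    and "dependent (distr M borel (\<lambda>\<omega>. (X \<omega>, Y \<omega>))) \<longleftrightarrow> \<not> indep_vectors M X Y"
proof -
  interpret M: prob_space M by fact
  let ?P = "distr M borel (\<lambda>\<omega>. (X \<omega>, Y \<omega>))"
  have m: "(\<lambda>\<omega>. (X \<omega>, Y \<omega>)) \<in> borel_measurable M" by measurable
  interpret P: prob_space ?P by (rule M.prob_space_distr[OF m])
  show "?P \<in> joint_laws"
    by (simp add: joint_laws_def P.prob_space_axioms)
  have fst_m: "(fst :: (real ^ 'r) \<times> (real ^ 's) \<Rightarrow> _) \<in> borel_measurable borel"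
    and snd_m: "(snd :: (real ^ 'r) \<times> (real ^ 's) \<Rightarrow> _) \<in> borel_measurable borel"
    by (simp_all add: borel_prod[symmetric])
  have f: "(fst :: (real ^ 'r) \<times> (real ^ 's) \<Rightarrow> _) -` A \<in> sets borel" if "A \<in> sets borel" for A
    using measurable_sets[OF fst_m that] by simp
  have s: "(snd :: (real ^ 'r) \<times> (real ^ 's) \<Rightarrow> _) -` B \<in> sets borel" if "B \<in> sets borel" for B
    using measurable_sets[OF snd_m that] by simp
  have fs_m: "(fst :: (real ^ 'r) \<times> (real ^ 's) \<Rightarrow> _) \<in> borel_measurable ?P"
    "(snd :: (real ^ 'r) \<times> (real ^ 's) \<Rightarrow> _) \<in> borel_measurable ?P"
    using fst_m snd_m by simp_all
  have vimage: "measure ?P S = measure M ((\<lambda>\<omega>. (X \<omega>, Y \<omega>)) -` S \<inter> space M)" if "S \<in> sets borel" for S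
    using that by (simp add: measure_distr[OF m])
  have "measure ?P (fst -` A \<inter> snd -` B) = measure M ((X -` A \<inter> space M) \<inter> (Y -` B \<inter> space M))"
    "measure ?P (fst -` A) = measure M (X -` A \<inter> space M)"
    "measure ?P (snd -` B) = measure M (Y -` B \<inter> space M)"
    if "A \<in> sets borel" "B \<in> sets borel" for A B
    using vimage[OF sets.Int[OF f[OF that(1)] s[OF that(2)]]] vimage[OF f[OF that(1)]]
      vimage[OF s[OF that(2)]]
    by (simp_all add: vimage_def Int_def conj_ac)
  then show "dependent ?P \<longleftrightarrow> \<not> indep_vectors M X Y"
    unfolding dependent_def indep_vectors_iff[OF P.prob_space_axioms fs_m]
      indep_vectors_iff[OF assms(1-3)]
    by simp
qed


subsection \<open>Hoeffding's \<open>D\<close>\<close>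

definition cdf_XY :: "((real ^ 'r) \<times> (real ^ 's)) measure \<Rightarrow> real ^ 'r \<Rightarrow> real ^ 's \<Rightarrow> real" where
  "cdf_XY P x y = \<P>(z in P. fst z \<le> x \<and> snd z \<le> y)"

definition cdf_X :: "((real ^ 'r) \<times> (real ^ 's)) measure \<Rightarrow> real ^ 'r \<Rightarrow> real" where
  "cdf_X P x = \<P>(z in P. fst z \<le> x)"

definition cdf_Y :: "((real ^ 'r) \<times> (real ^ 's)) measure \<Rightarrow> real ^ 's \<Rightarrow> real" where
  "cdf_Y P y = \<P>(z in P. snd z \<le> y)"

definition hoeffding_D :: "((real ^ 'r) \<times> (real ^ 's)) measure \<Rightarrow> real" where
  "hoeffding_D P = (\<integral>z. (cdf_XY P (fst z) (snd z) - cdf_X P (fst z) * cdf_Y P (snd z))\<^sup>2 \<partial>P)"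


subsection \<open>Block minors\<close>

definition bcube :: "(nat ^ 'd) set" where
  "bcube = {l. \<forall>i. l $ i \<in> {0, 1}}"

definition bvec :: "real ^ 'd \<Rightarrow> real ^ 'd \<Rightarrow> nat ^ 'd" where
  "bvec V v = (\<chi> i. of_bool (V $ i > v $ i))"

definition bprob ::
  "((real ^ 'r) \<times> (real ^ 's)) measure \<Rightarrow> real ^ 'r \<Rightarrow> real ^ 's \<Rightarrow> nat ^ 'r \<Rightarrow> nat ^ 's \<Rightarrow> real" where
  "bprob P x y lX lY = \<P>(z in P. bvec (fst z) x = lX \<and> bvec (snd z) y = lY)"

definition block_minor ::
  "((real ^ 'r) \<times> (real ^ 's)) measure \<Rightarrow> (nat ^ 'r) set \<Rightarrow> (nat ^ 's) set \<Rightarrow>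
   real ^ 'r \<Rightarrow> real ^ 's \<Rightarrow> real" where
  "block_minor P L R x y =
     bprob P x y 0 0 * (\<Sum>lX\<in>L. \<Sum>lY\<in>R. bprob P x y lX lY)
     - (\<Sum>lX\<in>L. bprob P x y lX 0) * (\<Sum>lY\<in>R. bprob P x y 0 lY)"

definition mu_joint_i ::
  "(nat ^ 'r) set \<Rightarrow> (nat ^ 's) set \<Rightarrow> ((real ^ 'r) \<times> (real ^ 's)) measure \<Rightarrow> real" where
  "mu_joint_i L R P = (\<integral>z. (block_minor P L R (fst z) (snd z))\<^sup>2 \<partial>P)"

text \<open>
  The second integrator is the product of all \<open>r + s\<close> univariate marginals; the product measures
  live on the function spaces \<open>'r \<Rightarrow> real\<close> and \<open>'s \<Rightarrow> real\<close>, whence the conversions to vectors.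
\<close>

definition mu_prod_i ::
  "(nat ^ 'r) set \<Rightarrow> (nat ^ 's) set \<Rightarrow> ((real ^ 'r) \<times> (real ^ 's)) measure \<Rightarrow> real" where
  "mu_prod_i L R P =
     (\<integral>u. (block_minor P L R (\<chi> a. fst u a) (\<chi> b. snd u b))\<^sup>2
        \<partial>((\<Pi>\<^sub>M a\<in>UNIV. distr P borel (\<lambda>z. fst z $ a)) \<Otimes>\<^sub>M
          (\<Pi>\<^sub>M b\<in>UNIV. distr P borel (\<lambda>z. snd z $ b))))"

definition mu_joint ::
  "nat \<Rightarrow> (nat \<Rightarrow> (nat ^ 'r) set) \<Rightarrow> (nat \<Rightarrow> (nat ^ 's) set) \<Rightarrow>
   ((real ^ 'r) \<times> (real ^ 's)) measure \<Rightarrow> real" where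
  "mu_joint k L R P = (\<Sum>i=1..k. mu_joint_i (L i) (R i) P)"

definition mu_prod ::
  "nat \<Rightarrow> (nat \<Rightarrow> (nat ^ 'r) set) \<Rightarrow> (nat \<Rightarrow> (nat ^ 's) set) \<Rightarrow>
   ((real ^ 'r) \<times> (real ^ 's)) measure \<Rightarrow> real" where
  "mu_prod k L R P = (\<Sum>i=1..k. mu_prod_i (L i) (R i) P)"


subsection \<open>Symmetric rank covariances\<close>

text \<open>
  A \<open>d \<times> m\<close> matrix is a function \<open>w :: nat \<Rightarrow> real ^ 'd\<close> giving its columns \<open>w 1, \<dots>, w m\<close>. Since
  \<open>rank_matrix m w\<close> ignores all other values of \<open>w\<close>, the condition \<open>I (rank_matrix m w) = I w\<close>
  for all \<open>w\<close> makes \<open>I\<close> a function of the first \<open>m\<close> columns only.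
\<close>

definition rank_matrix :: "nat \<Rightarrow> (nat \<Rightarrow> real ^ 'd) \<Rightarrow> nat \<Rightarrow> real ^ 'd" where
  "rank_matrix m w = (\<lambda>j\<in>{1..m}. \<chi> i. 1 + (\<Sum>k=1..m. of_bool (w k $ i < w j $ i)))"

definition rank_indicator :: "nat \<Rightarrow> ((nat \<Rightarrow> real ^ 'd) \<Rightarrow> real) \<Rightarrow> bool" where
  "rank_indicator m I \<longleftrightarrow> (\<forall>w. I w \<in> {0, 1} \<and> I (rank_matrix m w) = I w)"

definition permute_columns :: "(nat \<Rightarrow> nat) \<Rightarrow> (nat \<Rightarrow> 'v) \<Rightarrow> nat \<Rightarrow> 'v" where
  "permute_columns \<sigma> w = (\<lambda>j. w (inv' \<sigma> j))"

definition balanced_subgroup :: "nat \<Rightarrow> (nat \<Rightarrow> nat) set \<Rightarrow> bool" where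
  "balanced_subgroup m H \<longleftrightarrow> subgroup H (sym_group m) \<and>
     card {\<sigma>\<in>H. evenperm \<sigma>} = card {\<sigma>\<in>H. \<not> evenperm \<sigma>}"

definition src_mu ::
  "nat \<Rightarrow> ((nat \<Rightarrow> real ^ 'r) \<Rightarrow> real) \<Rightarrow> ((nat \<Rightarrow> real ^ 's) \<Rightarrow> real) \<Rightarrow> (nat \<Rightarrow> nat) set \<Rightarrow>
   ((real ^ 'r) \<times> (real ^ 's)) measure \<Rightarrow> real" where
  "src_mu m I_X I_Y H P =
     (\<integral>w. (\<Sum>\<sigma>\<in>H. of_int (sign \<sigma>) * I_X (permute_columns \<sigma> (\<lambda>j. fst (w j)))) *
          (\<Sum>\<sigma>\<in>H. of_int (sign \<sigma>) * I_Y (permute_columns \<sigma> (\<lambda>j. snd (w j))))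
        \<partial>(\<Pi>\<^sub>M j\<in>{1..m}. P))"

definition symmetric_rank_covariance ::
  "(((real ^ 'r) \<times> (real ^ 's)) measure \<Rightarrow> real) \<Rightarrow> bool" where
  "symmetric_rank_covariance \<mu> \<longleftrightarrow>
     (\<exists>m I_X I_Y H c. rank_indicator m I_X \<and> rank_indicator m I_Y \<and> balanced_subgroup m H \<and> c > 0 \<and>
        (\<forall>P\<in>joint_laws. \<mu> P = c * src_mu m I_X I_Y H P))"

definition summed_symmetric_rank_covariance ::
  "(((real ^ 'r) \<times> (real ^ 's)) measure \<Rightarrow> real) \<Rightarrow> bool" where
  "summed_symmetric_rank_covariance \<mu> \<longleftrightarrow>
     (\<exists>n \<nu>. n \<ge> 1 \<and> (\<forall>t\<in>{1..n::nat}. symmetric_rank_covariance (\<nu> t)) \<and>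
        (\<forall>P\<in>joint_laws. \<mu> P = (\<Sum>t=1..n. \<nu> t P)))"

end

theory Submission
  imports Defs
begin

text \<open>
  Write \<open>A(x, y)\<close> for a block minor along \<open>(0, L, 0, R)\<close>. Antisymmetrizing in two independent copies
  of \<open>(X, Y)\<close> gives \<open>2 A(x, y)\<close> as the expectation of \<open>skew L x X\<^sup>1 X\<^sup>2 * skew R y Y\<^sup>1 Y\<^sup>2\<close>, so with four
  copies \<open>4 A(x, y)\<^sup>2\<close> is the expectation of a product of two signed sums over the group generated by
  the transpositions \<open>(1 2)\<close> and \<open>(3 4)\<close>. Further copies supply the reference point \<open>(x, y)\<close>: a single
  one for the integral against the joint law, a separate one for every coordinate for the integral
  against the product of the univariate marginals.

  Summed over the partition, the block minors add up to \<open>F\<^sub>X\<^sub>Y - F\<^sub>X F\<^sub>Y\<close>. If all the integrals of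
  their squares vanish, then this function vanishes almost everywhere, which for the joint law means
  \<open>D = 0\<close>. For the product of the marginals it even vanishes everywhere. At \<open>x\<close> with a vanishing
  marginal distribution function this is trivial; otherwise the points \<open>u \<le> x\<close> all of whose marginal
  distribution functions exceed those at \<open>x\<close> minus \<open>\<delta>\<close> have positive measure, and there the joint
  distribution functions are within \<open>O(\<delta>)\<close> of their values at \<open>x\<close>.
\<close>

subsection \<open>Block probabilities and block minors\<close>

definition block_ind :: "(nat ^ 'd) set \<Rightarrow> real ^ 'd \<Rightarrow> real ^ 'd \<Rightarrow> real" where
  "block_ind L v V = of_bool (bvec V v \<in> L)"

text \<open>An expectation of a function of \<open>X\<close> times a function of \<open>Y\<close>:
  in this form products of block probabilities become integrals over independent copies of
  \<open>(X, Y)\<close>.\<close>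

definition block_prob ::
  "((real ^ 'r) \<times> (real ^ 's)) measure \<Rightarrow> (nat ^ 'r) set \<Rightarrow> (nat ^ 's) set \<Rightarrow> real ^ 'r \<Rightarrow> real ^ 's \<Rightarrow> real" where
  "block_prob P L R x y = (\<integral>z. block_ind L x (fst z) * block_ind R y (snd z) \<partial>P)"

text \<open>Measurability is asked coordinate by coordinate because later reference points are
  assembled from coordinates of different copies, or from a point of a function space. The target
  type is countable, so preimages of singletons suffice.\<close>

lemma measurable_bvec [measurable (raw)]:
  fixes f g :: "'a \<Rightarrow> real ^ 'd"
  assumes [measurable]: "\<And>i. (\<lambda>w. f w $ i) \<in> borel_measurable M" "\<And>i. (\<lambda>w. g w $ i) \<in> borel_measurable M"
  shows "(\<lambda>w. bvec (f w) (g w)) \<in> measurable M (count_space UNIV)"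
proof (subst measurable_count_space_eq2_countable, intro conjI ballI)
  fix l :: "nat ^ 'd"
  have "(\<lambda>w. bvec (f w) (g w)) -` {l} \<inter> space M = {w \<in> space M. \<forall>i. of_bool (g w $ i < f w $ i) = l $ i}"
    by (auto simp: bvec_def vec_eq_iff)
  also have "\<dots> \<in> sets M" by measurable
  finally show "(\<lambda>w. bvec (f w) (g w)) -` {l} \<inter> space M \<in> sets M" .
qed auto

lemma measurable_block_ind [measurable (raw)]:
  fixes f g :: "'a \<Rightarrow> real ^ 'd"
  assumes [measurable]: "\<And>i. (\<lambda>w. f w $ i) \<in> borel_measurable M" "\<And>i. (\<lambda>w. g w $ i) \<in> borel_measurable M"
  shows "(\<lambda>w. block_ind L (f w) (g w)) \<in> borel_measurable M"
  unfolding block_ind_def by measurable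

lemma borel_measurable_fst_snd [measurable]:
  "(fst :: ('a::second_countable_topology \<times> 'b::second_countable_topology) \<Rightarrow> 'a) \<in> borel_measurable borel"
  "(snd :: ('a::second_countable_topology \<times> 'b::second_countable_topology) \<Rightarrow> 'b) \<in> borel_measurable borel"
  by (simp_all add: borel_prod[symmetric])

lemma borel_measurable_vec_nth' [measurable (raw)]:
  fixes f :: "'a \<Rightarrow> real ^ 'd"
  assumes "f \<in> borel_measurable M"
  shows "(\<lambda>w. f w $ i) \<in> borel_measurable M"
  by (rule measurable_compose[OF assms borel_measurable_continuous_onI])
    (auto intro!: continuous_intros)

lemma abs_block_ind_le_1 [simp]: "\<bar>block_ind L v V\<bar> \<le> 1"
  by (simp add: block_ind_def)

lemma joint_laws_prob_space: "P \<in> joint_laws \<Longrightarrow> prob_space P"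
  and joint_laws_sets: "P \<in> joint_laws \<Longrightarrow> sets P = sets borel"
  by (simp_all add: joint_laws_def)

lemma integrable_bounded:
  fixes f :: "'a \<Rightarrow> real"
  assumes "finite_measure M" "f \<in> borel_measurable M" "\<And>x. \<bar>f x\<bar> \<le> B"
  shows "integrable M f"
  using assms by (intro finite_measure.integrable_const_bound[of M f B]) auto

lemma abs_prod_le_1: "\<bar>a\<bar> \<le> 1 \<Longrightarrow> \<bar>b\<bar> \<le> 1 \<Longrightarrow> \<bar>a * b\<bar> \<le> (1::real)"
  by (simp add: abs_mult mult_le_one)

lemma integrable_block_ind:
  assumes "P \<in> joint_laws"
  shows "integrable P (\<lambda>z. block_ind L x (fst z) * block_ind R y (snd z))"
proof -
  interpret prob_space P by (rule joint_laws_prob_space[OF assms])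
  note [measurable_cong] = joint_laws_sets[OF assms]
  show ?thesis
    by (rule integrable_bounded[where B=1]) (auto intro!: abs_prod_le_1 finite_measure_axioms)
qed

lemma block_prob_abs_le_1:
  assumes "P \<in> joint_laws"
  shows "\<bar>block_prob P L R x y\<bar> \<le> 1"
proof -
  interpret prob_space P by (rule joint_laws_prob_space[OF assms])
  have "\<bar>block_prob P L R x y\<bar> \<le> (\<integral>z. 1 \<partial>P)"
    unfolding block_prob_def
    by (rule integral_abs_bound_integral[OF integrable_block_ind[OF assms]]) (auto intro!: abs_prod_le_1)
  then show ?thesis by (simp add: prob_space)
qed

lemma measurable_block_prob [measurable (raw)]:
  fixes f :: "'a \<Rightarrow> real ^ 'r" and g :: "'a \<Rightarrow> real ^ 's"
  assumes P: "P \<in> joint_laws"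
    and [measurable]: "\<And>i. (\<lambda>w. f w $ i) \<in> borel_measurable M" "\<And>i. (\<lambda>w. g w $ i) \<in> borel_measurable M"
  shows "(\<lambda>w. block_prob P L R (f w) (g w)) \<in> borel_measurable M"
proof -
  interpret prob_space P by (rule joint_laws_prob_space[OF P])
  note [measurable_cong] = joint_laws_sets[OF P]
  show ?thesis unfolding block_prob_def by measurable
qed

lemma block_ind_sum: "finite L \<Longrightarrow> (\<Sum>l\<in>L. block_ind {l} v V) = block_ind L v V"
  by (simp add: block_ind_def of_bool_def)

lemma bprob_eq:
  fixes P :: "((real ^ 'r) \<times> (real ^ 's)) measure"
  assumes "P \<in> joint_laws"
  shows "bprob P x y lX lY = block_prob P {lX} {lY} x y"
proof -
  interpret prob_space P by (rule joint_laws_prob_space[OF assms])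
  note [measurable_cong] = joint_laws_sets[OF assms]
  let ?S = "{z \<in> space P. bvec (fst z) x = lX \<and> bvec (snd z) y = lY}"
  have "?S \<in> sets P" by measurable
  have "block_prob P {lX} {lY} x y = (\<integral>z. indicator ?S z \<partial>P)"
    unfolding block_prob_def
    by (rule Bochner_Integration.integral_cong) (auto simp: block_ind_def indicator_def)
  then show ?thesis by (simp add: bprob_def)
qed

lemma block_prob_sum:
  assumes "P \<in> joint_laws" "finite L" "finite R"
  shows "(\<Sum>l\<in>L. \<Sum>l'\<in>R. block_prob P {l} {l'} x y) = block_prob P L R x y"
proof -
  have "(\<Sum>l\<in>L. \<Sum>l'\<in>R. block_prob P {l} {l'} x y)
      = (\<integral>z. (\<Sum>l\<in>L. \<Sum>l'\<in>R. block_ind {l} x (fst z) * block_ind {l'} y (snd z)) \<partial>P)"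
    unfolding block_prob_def
    by (simp add: Bochner_Integration.integral_sum Bochner_Integration.integrable_sum
        integrable_block_ind[OF assms(1)])
  also have "\<dots> = block_prob P L R x y"
    unfolding block_prob_def
    by (simp add: sum_product[symmetric] block_ind_sum assms)
  finally show ?thesis .
qed

lemma block_minor_eq:
  assumes "P \<in> joint_laws" "finite L" "finite R"
  shows "block_minor P L R x y = block_prob P {0} {0} x y * block_prob P L R x y
     - block_prob P L {0} x y * block_prob P {0} R x y"
  using block_prob_sum[OF assms, of x y] block_prob_sum[OF assms(1,2), of "{0}" x y]
    block_prob_sum[OF assms(1) _ assms(3), of "{0}" x y]
  by (simp add: block_minor_def bprob_eq[OF assms(1)])

lemma measurable_block_minor [measurable (raw)]:
  fixes f :: "'a \<Rightarrow> real ^ 'r" and g :: "'a \<Rightarrow> real ^ 's"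
  assumes P: "P \<in> joint_laws" "finite L" "finite R"
    and [measurable]: "\<And>i. (\<lambda>w. f w $ i) \<in> borel_measurable M" "\<And>i. (\<lambda>w. g w $ i) \<in> borel_measurable M"
  shows "(\<lambda>w. block_minor P L R (f w) (g w)) \<in> borel_measurable M"
  unfolding block_minor_eq[OF P]
  by (intro borel_measurable_diff borel_measurable_times measurable_block_prob P(1)) measurable

lemma block_minor_abs_le_2:
  assumes "P \<in> joint_laws" "finite L" "finite R"
  shows "\<bar>block_minor P L R x y\<bar> \<le> 2"
proof -
  note b = block_prob_abs_le_1[OF assms(1)]
  show ?thesis
    unfolding block_minor_eq[OF assms]
    using abs_prod_le_1[OF b b, of "{0}" "{0}" x y L R x y] abs_prod_le_1[OF b b, of L "{0}" x y "{0}" R x y]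
    by linarith
qed

lemma block_minor_square_bounds:
  assumes "P \<in> joint_laws" "finite L" "finite R"
  shows "\<bar>(block_minor P L R x y)\<^sup>2\<bar> \<le> 4"
  using abs_le_square_iff[of "block_minor P L R x y" 2] block_minor_abs_le_2[OF assms, of x y] by simp

section \<open>The antisymmetrized indicators and their expectation\<close>

definition skew :: "(nat ^ 'd) set \<Rightarrow> real ^ 'd \<Rightarrow> real ^ 'd \<Rightarrow> real ^ 'd \<Rightarrow> real" where
  "skew L v V V' = block_ind {0} v V * block_ind L v V' - block_ind {0} v V' * block_ind L v V"

lemma abs_skew_le_1: "\<bar>skew L v V V'\<bar> \<le> 1"
  by (simp add: skew_def block_ind_def)

lemma measurable_skew [measurable (raw)]:
  fixes f g :: "'a \<Rightarrow> real ^ 'd"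
  assumes [measurable]: "\<And>i. (\<lambda>w. f w $ i) \<in> borel_measurable M" "\<And>i. (\<lambda>w. g w $ i) \<in> borel_measurable M"
     "\<And>i. (\<lambda>w. h w $ i) \<in> borel_measurable M"
  shows "(\<lambda>w. skew L (f w) (g w) (h w)) \<in> borel_measurable M"
  unfolding skew_def by measurable

text \<open>The product of the two differences expands into four terms in which \<open>z1\<close>
  and \<open>z2\<close> separate. The two positive terms both integrate to the first product of the
  minor, the two negative ones to the second, whence the factor 2.\<close>

lemma integral_skew:
  assumes P: "P \<in> joint_laws" and "finite L" "finite R"
  shows "(\<integral>z1. (\<integral>z2. skew L x (fst z1) (fst z2) * skew R y (snd z1) (snd z2) \<partial>P) \<partial>P)
    = 2 * block_minor P L R x y"
proof -
  note [simp] = integrable_block_ind[OF P]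
  define a where "a = (\<lambda>A B z. block_ind A x (fst z) * block_ind B y (snd z))"
  have [simp]: "integrable P (a A B)" for A B
    unfolding a_def by simp
  have a: "integral\<^sup>L P (a A B) = block_prob P A B x y" for A B
    by (simp add: a_def block_prob_def)
  have "skew L x (fst z1) (fst z2) * skew R y (snd z1) (snd z2)
    = a {0} {0} z1 * a L R z2 - a {0} R z1 * a L {0} z2 - a L {0} z1 * a {0} R z2 + a L R z1 * a {0} {0} z2"
    for z1 z2 by (simp add: skew_def a_def algebra_simps)
  then show ?thesis
    by (simp add: a block_minor_eq assms)
qed

section \<open>Summing the block minors over the partition\<close>

lemma bvec_eq_0_iff: "bvec V v = 0 \<longleftrightarrow> V \<le> v"
  by (auto simp: bvec_def vec_eq_iff less_eq_vec_def not_less)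

lemma bvec_in_bcube: "bvec V v \<in> bcube"
  by (simp add: bvec_def bcube_def)

lemma finite_bcube: "finite (bcube :: (nat ^ 'd) set)"
proof -
  have "bcube \<subseteq> vec_lambda ` (PiE UNIV (\<lambda>_. {0, 1 :: nat}) :: ('d \<Rightarrow> nat) set)"
  proof
    fix l :: "nat ^ 'd" assume "l \<in> bcube"
    then show "l \<in> vec_lambda ` (PiE UNIV (\<lambda>_. {0, 1 :: nat}) :: ('d \<Rightarrow> nat) set)"
      by (intro image_eqI[where x="vec_nth l"]) (simp_all add: bcube_def PiE_iff)
  qed
  then show ?thesis
    by (rule finite_subset) (simp add: finite_PiE)
qed

lemma block_ind_0: "block_ind {0} v V = of_bool (V \<le> v)"
  by (simp add: block_ind_def bvec_eq_0_iff)

lemma block_ind_complement: "block_ind (bcube - {0}) v V = 1 - of_bool (V \<le> v)"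
  by (simp add: block_ind_def bvec_in_bcube bvec_eq_0_iff)

text \<open>This is the determinant of a two-by-two table of total mass 1. With
  \<open>p = cdf_XY P x y\<close> and margins \<open>a\<close>, \<open>b\<close> the entries are
  \<open>p\<close>, \<open>a - p\<close>, \<open>b - p\<close> and \<open>1 - a - b + p\<close>, and
  the determinant collapses to \<open>p - a * b\<close>.\<close>

lemma block_minor_full:
  fixes P :: "((real ^ 'r) \<times> (real ^ 's)) measure"
  assumes P: "P \<in> joint_laws"
  shows "block_minor P (bcube - {0}) (bcube - {0}) x y = cdf_XY P x y - cdf_X P x * cdf_Y P y"
proof -
  interpret prob_space P by (rule joint_laws_prob_space[OF P])
  note [measurable_cong] = joint_laws_sets[OF P]
  let ?u = "\<lambda>z. of_bool (fst z \<le> x) :: real" and ?v = "\<lambda>z. of_bool (snd z \<le> y) :: real"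
  have u: "Measurable.pred P (\<lambda>z. fst z \<le> x)" and v: "Measurable.pred P (\<lambda>z. snd z \<le> y)"
    by (simp_all add: bvec_eq_0_iff[symmetric])
  have [measurable]: "?u \<in> borel_measurable P" "?v \<in> borel_measurable P"
    using u v by measurable
  have [simp]: "integrable P ?u" "integrable P ?v" "integrable P (\<lambda>z. ?u z * ?v z)"
    by (auto intro!: integrable_bounded[where B=1] finite_measure_axioms)
  have *: "(\<integral>z. of_bool (Q z) \<partial>P) = \<P>(z in P. Q z)" if "Measurable.pred P Q" for Q
  proof -
    have "(\<integral>z. of_bool (Q z) \<partial>P) = (\<integral>z. indicator {z \<in> space P. Q z} z \<partial>P :: real)"
      by (rule Bochner_Integration.integral_cong) (auto simp: indicator_def)
    then show ?thesis using that by simp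
  qed
  have uv: "Measurable.pred P (\<lambda>z. fst z \<le> x \<and> snd z \<le> y)" using u v by measurable
  have int: "integral\<^sup>L P ?u = cdf_X P x" "integral\<^sup>L P ?v = cdf_Y P y"
    "(\<integral>z. ?u z * ?v z \<partial>P) = cdf_XY P x y"
    using *[OF u] *[OF v] *[OF uv] by (simp_all only: cdf_X_def cdf_Y_def cdf_XY_def of_bool_conj)
  have "?u z * (1 - ?v z) = ?u z - ?u z * ?v z" "(1 - ?u z) * ?v z = ?v z - ?u z * ?v z"
    "(1 - ?u z) * (1 - ?v z) = 1 - ?u z - ?v z + ?u z * ?v z" for z
    by (simp_all add: algebra_simps)
  then show ?thesis
    by (simp add: block_minor_eq[OF P] finite_bcube block_prob_def block_ind_0 block_ind_complement int
        prob_space algebra_simps)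
qed

text \<open>The product of the two subtracted sums is itself a double sum, so a block minor is a sum
  of elementary minors over the pairs in \<open>L \<times> R\<close>. It is therefore additive over
  disjoint rectangles.\<close>

lemma block_minor_partition:
  assumes "finite I" "\<And>i. i \<in> I \<Longrightarrow> finite (L i)" "\<And>i. i \<in> I \<Longrightarrow> finite (R i)"
    and "disjoint_family_on (\<lambda>i. L i \<times> R i) I"
    and "(\<Union>i\<in>I. L i \<times> R i) = L' \<times> R'"
  shows "(\<Sum>i\<in>I. block_minor P (L i) (R i) x y) = block_minor P L' R' x y"
proof -
  let ?g = "\<lambda>(l, l'). bprob P x y 0 0 * bprob P x y l l' - bprob P x y l 0 * bprob P x y 0 l'"
  have minor: "block_minor P A B x y = (\<Sum>(l, l')\<in>A \<times> B. bprob P x y 0 0 * bprob P x y l l' - bprob P x y l 0 * bprob P x y 0 l')" for A B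
    unfolding sum.cartesian_product[symmetric]
    by (simp add: block_minor_def sum_distrib_left[of "bprob P x y 0 0"] sum_product sum_subtractf)
  have "(\<Sum>i\<in>I. block_minor P (L i) (R i) x y) = sum ?g (\<Union>i\<in>I. L i \<times> R i)"
    unfolding minor
    by (subst sum.UNION_disjoint) (use assms in \<open>auto simp: disjoint_family_on_def\<close>)
  then show ?thesis by (simp only: assms(5) minor)
qed

text \<open>Each integral is nonnegative, so all of them vanish, and with them almost everywhere
  each \<open>f i\<close>. Only the sum is recorded since that is what the partition identity
  evaluates.\<close>

lemma AE_zero_of_sum_integral_squares_zero:
  fixes f :: "'i \<Rightarrow> 'a \<Rightarrow> real"
  assumes "finite I" "\<And>i. i \<in> I \<Longrightarrow> integrable M (\<lambda>x. (f i x)\<^sup>2)"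
    and "(\<Sum>i\<in>I. \<integral>x. (f i x)\<^sup>2 \<partial>M) = 0"
  shows "AE x in M. (\<Sum>i\<in>I. f i x) = 0"
proof -
  have "(\<integral>x. (f i x)\<^sup>2 \<partial>M) = 0" if "i \<in> I" for i
    using assms that by (subst (asm) sum_nonneg_eq_0_iff) auto
  then have "AE x in M. \<forall>i\<in>I. f i x = 0"
    using assms by (auto simp: AE_finite_all integral_nonneg_eq_0_iff_AE)
  then show ?thesis by (rule AE_mp) (auto intro!: AE_I2)
qed

lemma mu_joint_zero_imp_hoeffding_D_zero:
  fixes L :: "nat \<Rightarrow> (nat ^ 'r) set" and R :: "nat \<Rightarrow> (nat ^ 's) set"
  assumes fin: "\<And>i. i \<in> {1..k} \<Longrightarrow> finite (L i)" "\<And>i. i \<in> {1..k} \<Longrightarrow> finite (R i)"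
    and part: "disjoint_family_on (\<lambda>i. L i \<times> R i) {1..k}"
      "(\<Union>i\<in>{1..k}. L i \<times> R i) = (bcube - {0}) \<times> (bcube - {0})"
    and P: "P \<in> joint_laws" and mu: "mu_joint k L R P = 0"
  shows "hoeffding_D P = 0"
proof -
  interpret prob_space P by (rule joint_laws_prob_space[OF P])
  note [measurable_cong] = joint_laws_sets[OF P]
  have "integrable P (\<lambda>z. (block_minor P (L i) (R i) (fst z) (snd z))\<^sup>2)" if "i \<in> {1..k}" for i
    using fin[OF that]
    by (intro integrable_bounded[where B=4] finite_measure_axioms block_minor_square_bounds
        borel_measurable_power measurable_block_minor P) measurable
  then have "AE z in P. (\<Sum>i=1..k. block_minor P (L i) (R i) (fst z) (snd z)) = 0"
    using mu by (intro AE_zero_of_sum_integral_squares_zero) (auto simp: mu_joint_def mu_joint_i_def)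
  then have "AE z in P. (cdf_XY P (fst z) (snd z) - cdf_X P (fst z) * cdf_Y P (snd z))\<^sup>2 = 0"
    by (simp only: block_minor_partition[OF finite_atLeastAtMost fin part] block_minor_full[OF P]) simp
  then show ?thesis
    unfolding hoeffding_D_def by (rule integral_eq_zero_AE)
qed

subsection \<open>Independence from factorization almost everywhere\<close>

text \<open>The sublevel set is downward closed, hence empty, the whole line, or a half line ending
  at its supremum \<open>t\<close>. The whole line forces \<open>1 \<le> c\<close>, because the
  distribution function tends to 1. A closed half line has mass \<open>cdf M t\<close>, an open one
  has the left limit at \<open>t\<close> as its mass, and both are at most \<open>c\<close>.\<close>

lemma (in real_distribution) measure_cdf_le:
  assumes "0 \<le> c"
  shows "measure M {u. cdf M u \<le> c} \<le> c"
proof -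
  let ?S = "{u. cdf M u \<le> c}"
  have down: "v \<in> ?S" if "u \<in> ?S" "v \<le> u" for u v
    using cdf_nondecreasing[OF that(2)] that(1) by simp
  consider "?S = {}" | "?S = UNIV" | "?S \<noteq> {}" "bdd_above ?S"
  proof (cases "bdd_above ?S")
    case False
    then have "\<exists>u\<in>?S. v \<le> u" for v
      by (meson bdd_above.I nle_le)
    then have "v \<in> ?S" for v using down[of _ v] by metis
    then have "?S = UNIV" by blast
    then show ?thesis using that(2) by blast
  next
    case True
    then show ?thesis using that(1,3) by argo
  qed
  then show ?thesis
  proof cases
    case 1
    show ?thesis using assms by (subst 1) simp
  next
    case 2
    then have "cdf M u \<le> c" for u by blast
    then have "1 \<le> c"
      by (intro tendsto_upperbound[OF cdf_lim_at_top_prob]) auto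
    then show ?thesis using order_trans[OF prob_le_1] by blast
  next
    case 3
    define t where "t = Sup ?S"
    have below: "u \<in> ?S" if u: "u < t" for u
    proof -
      obtain v where "v \<in> ?S" "u < v"
        using less_cSupD[OF 3(1) u[unfolded t_def]] by metis
      then show ?thesis using down[of v u] by simp
    qed
    have above: "u \<le> t" if "u \<in> ?S" for u
      using cSup_upper[OF that 3(2)] by (simp add: t_def)
    show ?thesis
    proof (cases "t \<in> ?S")
      case True
      then have "?S = {..t}" using below above by (auto simp: less_le)
      then have "measure M ?S = cdf M t" by (simp add: cdf_def)
      then show ?thesis using True by simp
    next
      case False
      then have "?S = {..<t}" using below above by (auto simp: less_le)
      moreover have "measure M {..<t} \<le> c"
      proof (rule tendsto_upperbound[OF cdf_at_left])
        show "\<forall>\<^sub>F u in at_left t. cdf M u \<le> c"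
          using below by (auto simp: eventually_at_filter)
      qed simp
      ultimately show ?thesis by simp
    qed
  qed
qed

text \<open>The half line up to \<open>x\<close> has mass \<open>cdf M x\<close> and is covered by
  the set in question and a sublevel set of mass at most \<open>c < cdf M x\<close>, so something is
  left for the former.\<close>

lemma (in real_distribution) measure_cdf_close_pos:
  assumes "0 < cdf M x" "0 < \<delta>"
  shows "0 < measure M {u. u \<le> x \<and> cdf M x - \<delta> \<le> cdf M u}"
proof -
  \<comment> \<open>The maximum with 0 supplies the nonnegative level that
    \<open>measure_cdf_le\<close> asks for; \<open>c\<close> stays below \<open>cdf M x\<close>
    because the latter is positive.\<close>
  define c where "c = max 0 (cdf M x - \<delta>)"
  have [measurable]: "cdf M \<in> borel_measurable borel"
    by (rule borel_measurable_mono) (simp add: mono_def cdf_nondecreasing)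
  have "cdf M x = measure M {..x}" by (simp add: cdf_def)
  also have "\<dots> \<le> measure M ({u. u \<le> x \<and> cdf M x - \<delta> \<le> cdf M u} \<union> {u. cdf M u \<le> c})"
    by (rule finite_measure_mono) (auto simp: c_def)
  also have "\<dots> \<le> measure M {u. u \<le> x \<and> cdf M x - \<delta> \<le> cdf M u} + measure M {u. cdf M u \<le> c}"
    by (rule measure_Un_le) measurable
  also have "measure M {u. cdf M u \<le> c} \<le> c"
    by (rule measure_cdf_le) (simp add: c_def)
  finally show ?thesis using assms unfolding c_def by linarith
qed

section \<open>Joint distribution functions compared with their margins\<close>

lemma (in prob_space) joint_cdf_le_marginal:
  fixes Z :: "'i \<Rightarrow> 'a \<Rightarrow> real"
  assumes [measurable]: "Z i \<in> borel_measurable M" and "i \<in> I"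
  shows "\<P>(z in M. \<forall>i\<in>I. Z i z \<le> x i) \<le> cdf (distr M borel (Z i)) (x i)"
proof -
  have "cdf (distr M borel (Z i)) (x i) = \<P>(z in M. Z i z \<le> x i)"
    by (auto simp: cdf_def measure_distr intro!: arg_cong[where f=prob])
  then show ?thesis
    using assms by (auto intro!: finite_measure_mono)
qed

text \<open>The difference of the two orthants is covered by the slabs
  \<open>u i < Z i z \<le> x i\<close>, whose probabilities are increments of the marginal
  distribution functions; a union bound finishes.\<close>

lemma (in prob_space) joint_cdf_diff_le:
  fixes Z :: "'i \<Rightarrow> 'a \<Rightarrow> real"
  assumes [measurable]: "\<And>i. Z i \<in> borel_measurable M" and "finite I" and le: "\<And>i. i \<in> I \<Longrightarrow> u i \<le> x i"
  shows "\<bar>\<P>(z in M. \<forall>i\<in>I. Z i z \<le> x i) - \<P>(z in M. \<forall>i\<in>I. Z i z \<le> u i)\<bar>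
    \<le> (\<Sum>i\<in>I. cdf (distr M borel (Z i)) (x i) - cdf (distr M borel (Z i)) (u i))"
proof -
  note [measurable] = \<open>finite I\<close>
  let ?A = "\<lambda>x. {z \<in> space M. \<forall>i\<in>I. Z i z \<le> x i}"
  have cdf: "cdf (distr M borel (Z i)) t = prob {z \<in> space M. Z i z \<le> t}" for i t
    by (auto simp: cdf_def measure_distr intro!: arg_cong[where f=prob])
  have diff: "prob {z \<in> space M. u i < Z i z \<and> Z i z \<le> x i}
    = cdf (distr M borel (Z i)) (x i) - cdf (distr M borel (Z i)) (u i)" if "i \<in> I" for i
    unfolding cdf using le[OF that]
    by (subst finite_measure_Diff[symmetric]) (auto intro!: arg_cong[where f=prob])
  have "?A u \<subseteq> ?A x" using le order_trans by blast
  then have le': "prob (?A u) \<le> prob (?A x)" and "prob (?A x) - prob (?A u) = prob (?A x - ?A u)"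
    by (auto simp: finite_measure_Diff intro!: finite_measure_mono)
  note this(2)
  also have "prob (?A x - ?A u) \<le> prob (\<Union>i\<in>I. {z \<in> space M. u i < Z i z \<and> Z i z \<le> x i})"
    by (rule finite_measure_mono) (use \<open>finite I\<close> in \<open>auto simp: not_le\<close>)
  also have "\<dots> \<le> (\<Sum>i\<in>I. prob {z \<in> space M. u i < Z i z \<and> Z i z \<le> x i})"
    by (rule finite_measure_subadditive_finite) (use \<open>finite I\<close> in auto)
  finally show ?thesis using le' by (simp add: diff)
qed

lemma abs_mult_diff_le:
  fixes a b c d :: real
  assumes "\<bar>a\<bar> \<le> 1" "\<bar>d\<bar> \<le> 1" "\<bar>a - c\<bar> \<le> e" "\<bar>b - d\<bar> \<le> e"
  shows "\<bar>a * b - c * d\<bar> \<le> 2 * e"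
proof -
  have "a * b - c * d = a * (b - d) + (a - c) * d" by (simp add: algebra_simps)
  moreover have "\<bar>a * (b - d)\<bar> \<le> 1 * e" "\<bar>(a - c) * d\<bar> \<le> e * 1"
    unfolding abs_mult using mult_mono[OF assms(1,4)] mult_mono[OF assms(3,2)] assms(3) by linarith+
  ultimately show ?thesis by linarith
qed

text \<open>
  Indexing all \<open>r + s\<close> coordinates by a sum type treats \<open>F\<^sub>X\<^sub>Y\<close>, \<open>F\<^sub>X\<close> and \<open>F\<^sub>Y\<close> uniformly, as joint
  distribution functions of subfamilies of coordinates.
\<close>

definition coord :: "'r + 's \<Rightarrow> (real ^ 'r) \<times> (real ^ 's) \<Rightarrow> real" where
  "coord i z = (case i of Inl a \<Rightarrow> fst z $ a | Inr b \<Rightarrow> snd z $ b)"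

lemma measurable_coord [measurable]: "coord i \<in> borel_measurable borel"
  using borel_measurable_vec_nth'[OF borel_measurable_fst_snd(1)]
    borel_measurable_vec_nth'[OF borel_measurable_fst_snd(2)]
  by (cases i) (simp_all add: coord_def[abs_def])

lemma cdf_eq_coord:
  shows "cdf_XY P x y = \<P>(z in P. \<forall>i\<in>UNIV. coord i z \<le> coord i (x, y))"
    and "cdf_X P x = \<P>(z in P. \<forall>i\<in>range Inl. coord i z \<le> coord i (x, y))"
    and "cdf_Y P y = \<P>(z in P. \<forall>i\<in>range Inr. coord i z \<le> coord i (x, y))"
  by (simp_all add: cdf_XY_def cdf_X_def cdf_Y_def coord_def less_eq_vec_def UNIV_sum ball_Un)

abbreviation marginal :: "((real ^ 'r) \<times> (real ^ 's)) measure \<Rightarrow> 'r + 's \<Rightarrow> real measure" where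
  "marginal P i \<equiv> distr P borel (coord i)"

text \<open>Exceptional null sets are avoided by moving from \<open>(x, y)\<close> to a nearby point
  below it, near in the sense of the marginal distribution functions. This closeness controls all
  joint distribution functions even where they jump.\<close>

lemma cdf_factor_everywhere:
  fixes P :: "((real ^ 'r) \<times> (real ^ 's)) measure"
  assumes P: "P \<in> joint_laws"
    and AE: "AE u in (\<Pi>\<^sub>M a\<in>UNIV. marginal P (Inl a)) \<Otimes>\<^sub>M (\<Pi>\<^sub>M b\<in>UNIV. marginal P (Inr b)).
      cdf_XY P (\<chi> a. fst u a) (\<chi> b. snd u b) = cdf_X P (\<chi> a. fst u a) * cdf_Y P (\<chi> b. snd u b)"
  shows "cdf_XY P x y = cdf_X P x * cdf_Y P y"
proof -
  interpret prob_space P by (rule joint_laws_prob_space[OF P])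
  note [measurable_cong] = joint_laws_sets[OF P]
  have dist: "real_distribution (marginal P i)" for i :: "'r + 's"
    by (rule real_distribution_distr) simp
  have coord: "coord i \<in> borel_measurable P" for i :: "'r + 's" by measurable
  define F where "F i = cdf (marginal P i)" for i :: "'r + 's"
  let ?z = "\<lambda>i. coord i (x, y)"
  show ?thesis
  proof (cases "\<exists>i. F i (?z i) = 0")
    case True
    then obtain i where i: "F i (?z i) = 0" by blast
    have 1: "cdf_XY P x y = 0"
      using joint_cdf_le_marginal[of coord i UNIV ?z, OF coord] i
      unfolding cdf_eq_coord(1)[of P x y] F_def by (simp add: measure_le_0_iff)
    \<comment> \<open>The coordinate \<open>i\<close> belongs to \<open>X\<close> or to
      \<open>Y\<close>, and the corresponding factor is bounded by
      \<open>F i (?z i) = 0\<close>.\<close>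
    have "cdf_X P x = 0 \<or> cdf_Y P y = 0"
      using joint_cdf_le_marginal[of coord i "range Inl" ?z, OF coord]
        joint_cdf_le_marginal[of coord i "range Inr" ?z, OF coord] i
      unfolding cdf_eq_coord(2)[of P x y] cdf_eq_coord(3)[of P y x] F_def
      by (cases i) (simp_all add: measure_le_0_iff)
    with 1 show ?thesis by auto
  next
    case False
    have F_pos: "0 < F i (?z i)" for i
    proof -
      interpret D: real_distribution "marginal P i" by (rule dist)
      show ?thesis using False D.cdf_nonneg[of "?z i"] by (metis F_def less_le)
    qed
    let ?M1 = "\<Pi>\<^sub>M a\<in>(UNIV :: 'r set). marginal P (Inl a)" and ?M2 = "\<Pi>\<^sub>M b\<in>(UNIV :: 's set). marginal P (Inr b)"
    let ?N = "real CARD('r + 's)"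
    \<comment> \<open>One \<open>?N * \<delta>\<close> is the error in \<open>cdf_XY\<close>; the
      other two come from the product, one for each factor.\<close>
    have close: "\<bar>cdf_XY P x y - cdf_X P x * cdf_Y P y\<bar> \<le> 3 * (?N * \<delta>)" if "\<delta> > 0" for \<delta> :: real
    proof -
      define A where "A i = {t. t \<le> ?z i \<and> F i (?z i) - \<delta> \<le> F i t}" for i
      have A_pos: "0 < emeasure (marginal P i) (A i)" for i
      proof -
        interpret D: real_distribution "marginal P i" by (rule dist)
        show ?thesis using D.measure_cdf_close_pos[of "?z i" \<delta>] F_pos[of i] that
          by (simp add: A_def F_def D.emeasure_eq_measure)
      qed
      have [measurable]: "A i \<in> sets borel" for i
      proof -
        interpret D: real_distribution "marginal P i" by (rule dist)
        have [measurable]: "F i \<in> borel_measurable borel"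
          unfolding F_def by (rule borel_measurable_mono) (simp add: mono_def D.cdf_nondecreasing)
        show ?thesis unfolding A_def by measurable
      qed
      interpret M1: product_prob_space "\<lambda>a. marginal P (Inl a)" "UNIV :: 'r set"
        by (rule product_prob_spaceI) (use dist in \<open>simp add: real_distribution_def\<close>)
      interpret M2: product_prob_space "\<lambda>b. marginal P (Inr b)" "UNIV :: 's set"
        by (rule product_prob_spaceI) (use dist in \<open>simp add: real_distribution_def\<close>)
      let ?S1 = "PiE UNIV (\<lambda>a. A (Inl a))" and ?S2 = "PiE UNIV (\<lambda>b. A (Inr b))"
      have S [measurable]: "?S1 \<in> sets ?M1" "?S2 \<in> sets ?M2"
        by (auto intro!: sets_PiM_I_finite)
      \<comment> \<open>The \<open>A i\<close> form a box, so its mass is a product of positive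
        numbers. It thus meets the set of full measure on which the factorization is given.\<close>
      have "emeasure (?M1 \<Otimes>\<^sub>M ?M2) (?S1 \<times> ?S2)
        = (\<Prod>a\<in>UNIV. emeasure (marginal P (Inl a)) (A (Inl a))) * (\<Prod>b\<in>UNIV. emeasure (marginal P (Inr b)) (A (Inr b)))"
        by (simp add: M2.P.emeasure_pair_measure_Times S M1.emeasure_PiM M2.emeasure_PiM)
      moreover have "\<dots> \<noteq> 0"
        using A_pos by (simp add: less_le)
      ultimately have not_AE: "\<not> (AE u in ?M1 \<Otimes>\<^sub>M ?M2. u \<notin> ?S1 \<times> ?S2)"
        by (subst AE_iff_measurable[where N="?S1 \<times> ?S2"]) (auto simp: space_pair_measure space_PiM)
      have "\<exists>u\<in>?S1 \<times> ?S2. cdf_XY P (\<chi> a. fst u a) (\<chi> b. snd u b) = cdf_X P (\<chi> a. fst u a) * cdf_Y P (\<chi> b. snd u b)"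
      proof (rule ccontr)
        assume none: "\<not> ?thesis"
        have "AE u in ?M1 \<Otimes>\<^sub>M ?M2. u \<notin> ?S1 \<times> ?S2"
          using AE by eventually_elim (use none in blast)
        with not_AE show False by contradiction
      qed
      then obtain u where u: "u \<in> ?S1 \<times> ?S2"
        and eq: "cdf_XY P (\<chi> a. fst u a) (\<chi> b. snd u b) = cdf_X P (\<chi> a. fst u a) * cdf_Y P (\<chi> b. snd u b)"
        by blast
      define x' y' where "x' = (\<chi> a. fst u a)" and "y' = (\<chi> b. snd u b)"
      let ?u = "\<lambda>i. coord i (x', y')"
      have uA: "?u i \<in> A i" for i
        using u by (cases i) (auto simp: coord_def x'_def y'_def)
      \<comment> \<open>Every coordinate contributes at most \<open>\<delta>\<close>. Bounding the
        number of coordinates by \<open>?N\<close> gives the same estimate for all three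
        distribution functions.\<close>
      have diff: "\<bar>\<P>(z in P. \<forall>i\<in>I. coord i z \<le> ?z i) - \<P>(z in P. \<forall>i\<in>I. coord i z \<le> ?u i)\<bar> \<le> ?N * \<delta>" for I
      proof -
        have "(\<Sum>i\<in>I. F i (?z i) - F i (?u i)) \<le> real (card I) * \<delta>"
          using uA by (intro sum_bounded_above) (auto simp: A_def algebra_simps)
        also have "\<dots> \<le> ?N * \<delta>"
          using that card_mono[of UNIV I] by (intro mult_right_mono) auto
        finally show ?thesis
          using joint_cdf_diff_le[of coord I ?u ?z, OF coord] uA by (simp add: A_def F_def)
      qed
      have "\<bar>cdf_XY P x y - cdf_XY P x' y'\<bar> \<le> ?N * \<delta>"
        "\<bar>cdf_X P x - cdf_X P x'\<bar> \<le> ?N * \<delta>" "\<bar>cdf_Y P y - cdf_Y P y'\<bar> \<le> ?N * \<delta>"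
        using diff[of UNIV] diff[of "range Inl"] diff[of "range Inr"]
        unfolding cdf_eq_coord(1)[of P] cdf_eq_coord(2)[of P x y] cdf_eq_coord(2)[of P x' y']
          cdf_eq_coord(3)[of P y x] cdf_eq_coord(3)[of P y' x'] by blast+
      moreover from this have "\<bar>cdf_X P x * cdf_Y P y - cdf_X P x' * cdf_Y P y'\<bar> \<le> 2 * (?N * \<delta>)"
        by (intro abs_mult_diff_le) (auto simp: cdf_X_def cdf_Y_def)
      ultimately show ?thesis
        using eq unfolding x'_def[symmetric] y'_def[symmetric] by linarith
    qed
    have "\<bar>cdf_XY P x y - cdf_X P x * cdf_Y P y\<bar> \<le> 0 + e" if "e > 0" for e
    proof -
      have N: "0 < ?N" using zero_less_card_finite[where 'a="'r + 's"] by (simp only: of_nat_0_less_iff)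
      moreover have "3 * (n * (e / (3 * n))) = e" if "0 < n" for n :: real
        using that by simp
      ultimately show ?thesis
        using close[of "e / (3 * ?N)"] \<open>0 < e\<close> by (metis add_0 divide_pos_pos mult_pos_pos zero_less_numeral)
    qed
    then have "\<bar>cdf_XY P x y - cdf_X P x * cdf_Y P y\<bar> \<le> 0" by (rule field_le_epsilon)
    then show ?thesis by simp
  qed
qed

text \<open>A pi-system argument: lower orthants generate the Borel sets, and two of them intersect
  in the orthant below the componentwise infimum. Factorization on orthants thus extends to the
  generated sigma-algebras.\<close>

lemma not_dependent_of_cdf_factor:
  fixes P :: "((real ^ 'r) \<times> (real ^ 's)) measure"
  assumes P: "P \<in> joint_laws" and eq: "\<And>x y. cdf_XY P x y = cdf_X P x * cdf_Y P y"
  shows "\<not> dependent P"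
proof -
  interpret prob_space P by (rule joint_laws_prob_space[OF P])
  note [measurable_cong] = joint_laws_sets[OF P]
  have sp: "space P = UNIV" using sets_eq_imp_space_eq[OF joint_laws_sets[OF P]] by simp
  let ?A = "{fst -` A \<inter> space P | A. A \<in> range (atMost :: real ^ 'r \<Rightarrow> _)}"
  let ?B = "{snd -` A \<inter> space P | A. A \<in> range (atMost :: real ^ 's \<Rightarrow> _)}"
  have "{fst -` A \<inter> space P | A. A \<in> sets borel} = sigma_sets (space P) ?A"
    "{snd -` B \<inter> space P | B. B \<in> sets borel} = sigma_sets (space P) ?B"
    unfolding borel_eq_atMost by (simp_all add: sigma_sets_vimage_commute)
  moreover have "indep_set (sigma_sets (space P) ?A) (sigma_sets (space P) ?B)"
  proof (rule indep_set_sigma_sets)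
    have "fst -` {..x} \<inter> space P \<in> events" "snd -` {..y} \<inter> space P \<in> events"
      for x :: "real ^ 'r" and y :: "real ^ 's" by measurable
    moreover have "prob ((fst -` {..x} \<inter> space P) \<inter> (snd -` {..y} \<inter> space P))
      = prob (fst -` {..x} \<inter> space P) * prob (snd -` {..y} \<inter> space P)" for x :: "real ^ 'r" and y :: "real ^ 's"
      using eq[of x y] by (simp add: cdf_XY_def cdf_X_def cdf_Y_def sp vimage_def Int_def)
    ultimately show "indep_set ?A ?B"
      unfolding indep_sets2_eq by blast
    have inf: "{..a} \<inter> {..b} = {..inf a b}" for a b :: "real ^ 'd" by auto
    show "Int_stable ?A" "Int_stable ?B"
      by (auto simp: Int_stable_def vimage_Int[symmetric] inf sp) blast+
  qed
  ultimately show ?thesis by (simp add: dependent_def indep_vectors_def)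
qed

lemma mu_prod_zero_imp_not_dependent:
  fixes L :: "nat \<Rightarrow> (nat ^ 'r) set" and R :: "nat \<Rightarrow> (nat ^ 's) set"
  assumes fin: "\<And>i. i \<in> {1..k} \<Longrightarrow> finite (L i)" "\<And>i. i \<in> {1..k} \<Longrightarrow> finite (R i)"
    and part: "disjoint_family_on (\<lambda>i. L i \<times> R i) {1..k}"
      "(\<Union>i\<in>{1..k}. L i \<times> R i) = (bcube - {0}) \<times> (bcube - {0})"
    and P: "P \<in> joint_laws" and mu: "mu_prod k L R P = 0"
  shows "\<not> dependent P"
proof -
  interpret prob_space P by (rule joint_laws_prob_space[OF P])
  note [measurable_cong] = joint_laws_sets[OF P]
  have coord: "(\<lambda>z. fst z $ a) = coord (Inl a)" "(\<lambda>z. snd z $ b) = coord (Inr b)" for a :: 'r and b :: 's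
    by (simp_all add: coord_def fun_eq_iff)
  let ?M1 = "\<Pi>\<^sub>M a\<in>(UNIV :: 'r set). marginal P (Inl a)" and ?M2 = "\<Pi>\<^sub>M b\<in>(UNIV :: 's set). marginal P (Inr b)"
  have "prob_space (?M1 \<Otimes>\<^sub>M ?M2)"
    by (intro prob_space_pair prob_space_PiM prob_space_distr) simp_all
  then have fm: "finite_measure (?M1 \<Otimes>\<^sub>M ?M2)" by (simp add: prob_space_def)
  have "integrable (?M1 \<Otimes>\<^sub>M ?M2) (\<lambda>u. (block_minor P (L i) (R i) (\<chi> a. fst u a) (\<chi> b. snd u b))\<^sup>2)"
    if "i \<in> {1..k}" for i
    using fin[OF that]
    by (intro integrable_bounded[where B=4] fm block_minor_square_bounds
        borel_measurable_power measurable_block_minor P) simp_all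
  then have "AE u in ?M1 \<Otimes>\<^sub>M ?M2. (\<Sum>i=1..k. block_minor P (L i) (R i) (\<chi> a. fst u a) (\<chi> b. snd u b)) = 0"
    using mu by (intro AE_zero_of_sum_integral_squares_zero) (auto simp: mu_prod_def mu_prod_i_def coord)
  then have "AE u in ?M1 \<Otimes>\<^sub>M ?M2. cdf_XY P (\<chi> a. fst u a) (\<chi> b. snd u b) = cdf_X P (\<chi> a. fst u a) * cdf_Y P (\<chi> b. snd u b)"
    by (simp only: block_minor_partition[OF finite_atLeastAtMost fin part] block_minor_full[OF P]) simp
  then show ?thesis
    by (intro not_dependent_of_cdf_factor cdf_factor_everywhere P)
qed

subsection \<open>Block minors as symmetric rank covariances\<close>

hide_const (open) Finite_Cartesian_Product.transpose

text \<open>Ranks preserve strict order: if \<open>v i < v j\<close>, every index counted for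
  \<open>i\<close> is counted for \<open>j\<close>, and \<open>i\<close> itself is counted only for
  \<open>j\<close>. Otherwise the count for \<open>j\<close> is no larger.\<close>

lemma sum_of_bool_less_iff:
  fixes v :: "nat \<Rightarrow> real"
  assumes "i \<in> I" "finite I"
  shows "(\<Sum>k\<in>I. of_bool (v k < v i) :: real) < (\<Sum>k\<in>I. of_bool (v k < v j)) \<longleftrightarrow> v i < v j"
proof
  assume "v i < v j"
  then show "(\<Sum>k\<in>I. of_bool (v k < v i) :: real) < (\<Sum>k\<in>I. of_bool (v k < v j))"
    using assms by (intro sum_strict_mono_ex1 ballI bexI[of _ i]) auto
next
  assume *: "(\<Sum>k\<in>I. of_bool (v k < v i) :: real) < (\<Sum>k\<in>I. of_bool (v k < v j))"
  show "v i < v j"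
  proof (rule ccontr)
    assume "\<not> v i < v j"
    then have "(\<Sum>k\<in>I. of_bool (v k < v j) :: real) \<le> (\<Sum>k\<in>I. of_bool (v k < v i))"
      by (intro sum_mono) auto
    with * show False by simp
  qed
qed

lemma rank_matrix_less_iff:
  assumes "i \<in> {1..m}" "j \<in> {1..m}"
  shows "rank_matrix m w i $ a < rank_matrix m w j $ a \<longleftrightarrow> w i $ a < w j $ a"
  using sum_of_bool_less_iff[of i "{1..m}" "\<lambda>k. w k $ a" j] assms by (simp add: rank_matrix_def)

text \<open>
  Copies \<open>1, \<dots>, 4\<close> enter the block minors, and coordinate \<open>a\<close> of the reference point is read off from
  copy \<open>e a \<ge> 5\<close>, so that \<open>two_swaps\<close> leaves the reference point fixed.
\<close>

definition reference :: "('d \<Rightarrow> nat) \<Rightarrow> (nat \<Rightarrow> real ^ 'd) \<Rightarrow> real ^ 'd" where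
  "reference e w = (\<chi> a. w (e a) $ a)"

text \<open>The term of the identity permutation in the signed sum: copies 1 and 3 lie in the zero
  block, copies 2 and 4 in the block \<open>L\<close>.\<close>

definition quad_indicator :: "('d \<Rightarrow> nat) \<Rightarrow> (nat ^ 'd) set \<Rightarrow> (nat \<Rightarrow> real ^ 'd) \<Rightarrow> real" where
  "quad_indicator e L w = block_ind {0} (reference e w) (w 1) * block_ind L (reference e w) (w 2)
     * block_ind {0} (reference e w) (w 3) * block_ind L (reference e w) (w 4)"

text \<open>The indicator sees \<open>w\<close> only through strict comparisons of entries within
  one row, and these survive the passage to ranks.\<close>

lemma rank_indicator_quad_indicator:
  assumes e: "\<And>a. e a \<in> {1..m}" and m: "4 \<le> m"
  shows "rank_indicator m (quad_indicator e L)"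
proof -
  have "bvec (rank_matrix m w j) (reference e (rank_matrix m w)) = bvec (w j) (reference e w)"
    if "j \<in> {1..m}" for w and j
    by (simp add: bvec_def reference_def rank_matrix_less_iff[OF e that])
  then show ?thesis
    using m by (simp add: rank_indicator_def quad_indicator_def block_ind_def)
qed

section \<open>The group generated by two disjoint transpositions\<close>

text \<open>A Klein four-group with two even and two odd elements. Each element is its own inverse,
  so the inverse in \<open>permute_columns\<close> disappears.\<close>

definition two_swaps :: "(nat \<Rightarrow> nat) set" where
  "two_swaps = {id, transpose 1 2, transpose 3 4, transpose 1 2 \<circ> transpose 3 4}"

text \<open>Ensures that sums over \<open>two_swaps\<close> have four terms and that each parity
  class has two elements. Evaluation at 1 or at 3 tells any two of the permutations apart.\<close>

lemma two_swaps_distinct: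
  "transpose 1 2 \<noteq> (id :: nat \<Rightarrow> nat)" "transpose 3 4 \<noteq> (id :: nat \<Rightarrow> nat)"
  "transpose 1 2 \<circ> transpose 3 4 \<noteq> (id :: nat \<Rightarrow> nat)"
  "transpose 1 2 \<noteq> (transpose 3 4 :: nat \<Rightarrow> nat)"
  "transpose 1 2 \<circ> transpose 3 4 \<noteq> (transpose 1 2 :: nat \<Rightarrow> nat)"
  "transpose 1 2 \<circ> transpose 3 4 \<noteq> (transpose 3 4 :: nat \<Rightarrow> nat)"
proof -
  have neq: "f \<noteq> g" if "f x \<noteq> g x" for f g :: "nat \<Rightarrow> nat" and x using that by blast
  show "transpose 1 2 \<noteq> (id :: nat \<Rightarrow> nat)" "transpose 1 2 \<circ> transpose 3 4 \<noteq> (id :: nat \<Rightarrow> nat)"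
    "transpose 1 2 \<noteq> (transpose 3 4 :: nat \<Rightarrow> nat)"
    "transpose 1 2 \<circ> transpose 3 4 \<noteq> (transpose 3 4 :: nat \<Rightarrow> nat)"
    by (rule neq[of _ 1], simp add: Transposition.transpose_def)+
  show "transpose 3 4 \<noteq> (id :: nat \<Rightarrow> nat)"
    "transpose 1 2 \<circ> transpose 3 4 \<noteq> (transpose 1 2 :: nat \<Rightarrow> nat)"
    by (rule neq[of _ 3], simp add: Transposition.transpose_def)+
qed

lemma inv_two_swaps:
  assumes "\<sigma> \<in> two_swaps"
  shows "inv' \<sigma> = \<sigma>"
proof -
  have "\<sigma> \<circ> \<sigma> = id"
    using assms unfolding two_swaps_def
    by (elim insertE emptyE) (simp_all add: fun_eq_iff Transposition.transpose_def)
  then show ?thesis by (intro inv_unique_comp)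
qed

lemma sign_two_swaps:
  "sign (transpose 1 (2 :: nat)) = -1" "sign (transpose 3 (4 :: nat)) = -1"
  "sign (transpose 1 2 \<circ> transpose 3 (4 :: nat)) = 1"
  by (simp_all add: sign_swap_id sign_compose permutation_swap_id)

lemma two_swaps_permutes: "4 \<le> m \<Longrightarrow> \<sigma> \<in> two_swaps \<Longrightarrow> \<sigma> permutes {1..m}"
  unfolding two_swaps_def by (auto intro!: permutes_compose permutes_swap_id permutes_id)

lemma two_swaps_closed: "\<sigma> \<in> two_swaps \<Longrightarrow> \<tau> \<in> two_swaps \<Longrightarrow> \<sigma> \<circ> \<tau> \<in> two_swaps"
  unfolding two_swaps_def by (elim insertE emptyE) (simp_all add: fun_eq_iff Transposition.transpose_def)

lemma balanced_two_swaps: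
  assumes "4 \<le> m"
  shows "balanced_subgroup m two_swaps"
proof -
  have "subgroup two_swaps (sym_group m)"
  proof
    show "two_swaps \<subseteq> carrier (sym_group m)"
      using two_swaps_permutes[OF assms] by (auto simp: sym_group_carrier)
    show "\<sigma> \<otimes>\<^bsub>sym_group m\<^esub> \<tau> \<in> two_swaps" if "\<sigma> \<in> two_swaps" "\<tau> \<in> two_swaps" for \<sigma> \<tau>
      using two_swaps_closed[OF that] by (simp add: sym_group_mult)
    show "\<one>\<^bsub>sym_group m\<^esub> \<in> two_swaps"
      by (simp add: sym_group_one two_swaps_def)
    show "inv\<^bsub>sym_group m\<^esub> \<sigma> \<in> two_swaps" if "\<sigma> \<in> two_swaps" for \<sigma>
      using that two_swaps_permutes[OF assms that]
      by (simp add: sym_group_inv_equality sym_group_carrier inv_two_swaps)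
  qed
  moreover have "{\<sigma>\<in>two_swaps. evenperm \<sigma>} = {id, transpose 1 2 \<circ> transpose 3 4}"
    "{\<sigma>\<in>two_swaps. \<not> evenperm \<sigma>} = {transpose 1 2, transpose 3 4}"
    using sign_two_swaps by (auto simp: two_swaps_def sign_def split: if_splits)
  ultimately show ?thesis
    using two_swaps_distinct by (simp add: balanced_subgroup_def)
qed

text \<open>The permutations fix every index from 5 on, hence the reference point. The signs
  multiply over the two transpositions, so the four terms factor into a difference for copies 1, 2
  and one for copies 3, 4.\<close>

lemma sum_two_swaps:
  fixes w :: "nat \<Rightarrow> real ^ 'd"
  assumes "\<And>a. 5 \<le> e a"
  shows "(\<Sum>\<sigma>\<in>two_swaps. of_int (sign \<sigma>) * quad_indicator e L (permute_columns \<sigma> w))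
    = skew L (reference e w) (w 1) (w 2) * skew L (reference e w) (w 3) (w 4)"
proof -
  have ref: "reference e (permute_columns \<sigma> w) = reference e w" if "\<sigma> \<in> two_swaps" for \<sigma>
  proof -
    have "\<sigma> (e a) = e a" for a
      using that assms[of a] by (auto simp: two_swaps_def Transposition.transpose_def)
    then show ?thesis
      by (simp add: reference_def permute_columns_def inv_two_swaps[OF that])
  qed
  let ?b = "\<lambda>L j. block_ind L (reference e w) (w j)"
  have quad: "quad_indicator e L (permute_columns \<sigma> w) = ?b {0} (\<sigma> 1) * ?b L (\<sigma> 2) * ?b {0} (\<sigma> 3) * ?b L (\<sigma> 4)"
    if "\<sigma> \<in> two_swaps" for \<sigma>
    unfolding quad_indicator_def ref[OF that]
    by (simp add: permute_columns_def inv_two_swaps[OF that])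
  have "(\<Sum>\<sigma>\<in>two_swaps. of_int (sign \<sigma>) * quad_indicator e L (permute_columns \<sigma> w))
    = (\<Sum>\<sigma>\<in>two_swaps. of_int (sign \<sigma>) * (?b {0} (\<sigma> 1) * ?b L (\<sigma> 2) * ?b {0} (\<sigma> 3) * ?b L (\<sigma> 4)))"
    by (rule sum.cong) (simp_all add: quad)
  also have "\<dots> = skew L (reference e w) (w 1) (w 2) * skew L (reference e w) (w 3) (w 4)"
    using two_swaps_distinct unfolding two_swaps_def
    by (simp add: eq_commute sign_two_swaps[unfolded One_nat_def] sign_id) (simp add: skew_def Transposition.transpose_def algebra_simps)
  finally show ?thesis .
qed

section \<open>Integration over independent copies\<close>

lemma integral_PiM_pair:
  fixes h :: "'a \<Rightarrow> 'a \<Rightarrow> real" and i j :: 'i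
  assumes "prob_space M" "i \<noteq> j" and [measurable]: "case_prod h \<in> borel_measurable (M \<Otimes>\<^sub>M M)"
    and bound: "\<And>x y. \<bar>h x y\<bar> \<le> B"
  shows "(\<integral>w. h (w i) (w j) \<partial>(\<Pi>\<^sub>M k\<in>{i, j}. M)) = (\<integral>x. (\<integral>y. h x y \<partial>M) \<partial>M)"
proof -
  interpret prob_space M by fact
  interpret product_prob_space "\<lambda>_::'i. M" "{i, j}"
    by (rule product_prob_spaceI) fact
  \<comment> \<open>Inserting \<open>j\<close> into \<open>{i}\<close> makes \<open>w j\<close> the
    inner variable of integration, as the right-hand side requires.\<close>
  have "(\<integral>w. h (w i) (w j) \<partial>(\<Pi>\<^sub>M k\<in>insert j {i}. M))
    = (\<integral>w. (\<integral>y. h ((w(j := y)) i) ((w(j := y)) j) \<partial>M) \<partial>(\<Pi>\<^sub>M k\<in>{i}. M))"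
    by (rule product_integral_insert)
      (use \<open>i \<noteq> j\<close> bound in \<open>auto intro!: integrable_bounded[where B=B] prob_space.finite_measure prob_space_PiM assms\<close>)
  also have "\<dots> = (\<integral>w. (\<integral>y. h (w i) y \<partial>M) \<partial>(\<Pi>\<^sub>M k\<in>{i}. M))"
    using \<open>i \<noteq> j\<close> by simp
  also have "\<dots> = (\<integral>x. (\<integral>y. h x y \<partial>M) \<partial>M)"
    by (rule product_integral_singleton) measurable
  finally show ?thesis by (simp add: insert_commute)
qed

lemma integral_PiM_two_pairs:
  fixes h g :: "'a \<Rightarrow> 'a \<Rightarrow> real"
  assumes "prob_space M"
    and [measurable]: "case_prod h \<in> borel_measurable (M \<Otimes>\<^sub>M M)" "case_prod g \<in> borel_measurable (M \<Otimes>\<^sub>M M)"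
    and bound: "\<And>x y. \<bar>h x y\<bar> \<le> 1" "\<And>x y. \<bar>g x y\<bar> \<le> 1"
  shows "(\<integral>w. h (w 1) (w 2) * g (w 3) (w 4) \<partial>(\<Pi>\<^sub>M k\<in>{1, 2} \<union> {3, 4 :: nat}. M))
    = (\<integral>x. (\<integral>y. h x y \<partial>M) \<partial>M) * (\<integral>x. (\<integral>y. g x y \<partial>M) \<partial>M)"
proof -
  interpret prob_space M by fact
  interpret product_prob_space "\<lambda>_::nat. M" "{1, 2} \<union> {3, 4}"
    by (rule product_prob_spaceI) fact
  have "(\<integral>w. h (w 1) (w 2) * g (w 3) (w 4) \<partial>(\<Pi>\<^sub>M k\<in>{1, 2} \<union> {3, 4 :: nat}. M))
    = (\<integral>x. (\<integral>y. h (merge {1, 2} {3, 4 :: nat} (x, y) 1) (merge {1, 2} {3, 4} (x, y) 2)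
        * g (merge {1, 2} {3, 4} (x, y) 3) (merge {1, 2} {3, 4} (x, y) 4) \<partial>(\<Pi>\<^sub>M k\<in>{3, 4}. M)) \<partial>(\<Pi>\<^sub>M k\<in>{1, 2}. M))"
    by (rule product_integral_fold)
      (use bound in \<open>auto intro!: integrable_bounded[where B=1] prob_space.finite_measure prob_space_PiM assms abs_prod_le_1\<close>)
  also have "\<dots> = (\<integral>x. h (x 1) (x 2) \<partial>(\<Pi>\<^sub>M k\<in>{1, 2 :: nat}. M)) * (\<integral>y. g (y 3) (y 4) \<partial>(\<Pi>\<^sub>M k\<in>{3, 4 :: nat}. M))"
    by (simp add: merge_def)
  also have "\<dots> = (\<integral>x. (\<integral>y. h x y \<partial>M) \<partial>M) * (\<integral>x. (\<integral>y. g x y \<partial>M) \<partial>M)"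
    using integral_PiM_pair[OF assms(1) _ assms(2) bound(1), of 1 "2 :: nat"]
      integral_PiM_pair[OF assms(1) _ assms(3) bound(2), of 3 "4 :: nat"] by simp
  finally show ?thesis .
qed

text \<open>With the reference copies held fixed, the pairs (1, 2) and (3, 4) are independent and
  identically distributed. Each contributes twice the block minor by \<open>integral_skew\<close>,
  which gives four times its square.\<close>

lemma src_mu_quad_indicator:
  fixes P :: "((real ^ 'r) \<times> (real ^ 's)) measure"
  assumes P: "P \<in> joint_laws" and fin: "finite L" "finite R"
    and ex: "\<And>a. ex a \<in> {5..m}" and ey: "\<And>b. ey b \<in> {5..m}"
  shows "src_mu m (quad_indicator ex L) (quad_indicator ey R) two_swaps P
    = 4 * (\<integral>w. (block_minor P L R (\<chi> a. fst (w (ex a)) $ a) (\<chi> b. snd (w (ey b)) $ b))\<^sup>2 \<partial>(\<Pi>\<^sub>M j\<in>{5..m}. P))"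
proof -
  interpret prob_space P by (rule joint_laws_prob_space[OF P])
  note [measurable_cong] = joint_laws_sets[OF P]
  have "5 \<le> m" using ex[of undefined] by auto
  \<comment> \<open>The reference copies stand first so that Fubini makes them the outer
    integral.\<close>
  then have I: "{1..m} = {5..m} \<union> ({1, 2} \<union> {3, 4})" by auto
  interpret Pi: product_prob_space "\<lambda>_::nat. P" "{1..m}"
    by (rule product_prob_spaceI) (rule prob_space_axioms)
  let ?x = "\<lambda>w :: nat \<Rightarrow> (real ^ 'r) \<times> (real ^ 's). reference ex (\<lambda>j. fst (w j))"
    and ?y = "\<lambda>w :: nat \<Rightarrow> (real ^ 'r) \<times> (real ^ 's). reference ey (\<lambda>j. snd (w j))"
  define h where "h w z1 z2 = skew L (?x w) (fst z1) (fst z2) * skew R (?y w) (snd z1) (snd z2)" for w z1 z2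
  have h_bound: "\<bar>h w z1 z2\<bar> \<le> 1" for w z1 z2
    unfolding h_def by (intro abs_prod_le_1 abs_skew_le_1)
  have sum: "(\<Sum>\<sigma>\<in>two_swaps. of_int (sign \<sigma>) * quad_indicator ex L (permute_columns \<sigma> (\<lambda>j. fst (w j)))) *
      (\<Sum>\<sigma>\<in>two_swaps. of_int (sign \<sigma>) * quad_indicator ey R (permute_columns \<sigma> (\<lambda>j. snd (w j))))
    = h w (w 1) (w 2) * h w (w 3) (w 4)" for w :: "nat \<Rightarrow> (real ^ 'r) \<times> (real ^ 's)"
    using ex ey by (subst (1 2) sum_two_swaps) (auto simp: h_def)
  have comp: "(\<lambda>w. w j) \<in> measurable (\<Pi>\<^sub>M j\<in>{1..m}. P) borel" if "j \<in> {1..m}" for j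
    using measurable_component_singleton[OF that, of "\<lambda>_. P"]
    by (simp add: measurable_cong_sets[OF refl joint_laws_sets[OF P]])
  have fst_comp: "(\<lambda>w. fst (w j) $ a) \<in> borel_measurable (\<Pi>\<^sub>M j\<in>{1..m}. P)" if "j \<in> {1..m}" for j a
    by (intro borel_measurable_vec_nth' measurable_compose[OF comp[OF that] borel_measurable_fst_snd(1)])
  have snd_comp: "(\<lambda>w. snd (w j) $ b) \<in> borel_measurable (\<Pi>\<^sub>M j\<in>{1..m}. P)" if "j \<in> {1..m}" for j b
    by (intro borel_measurable_vec_nth' measurable_compose[OF comp[OF that] borel_measurable_fst_snd(2)])
  have mem: "ex a \<in> {1..m}" "ey b \<in> {1..m}" "1 \<in> {1..m}" "2 \<in> {1..m}" "3 \<in> {1..m}" "4 \<in> {1..m}" for a b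
    using \<open>5 \<le> m\<close> ex[of a] ey[of b] by auto
  have meas: "(\<lambda>w. h w (w 1) (w 2) * h w (w 3) (w 4)) \<in> borel_measurable (\<Pi>\<^sub>M j\<in>{1..m}. P)"
    unfolding h_def reference_def
    by (intro borel_measurable_times measurable_skew; (subst vec_lambda_beta)?; intro fst_comp snd_comp mem)
  have int: "integrable (\<Pi>\<^sub>M j\<in>{1..m}. P) (\<lambda>w. h w (w 1) (w 2) * h w (w 3) (w 4))"
    by (rule integrable_bounded[OF _ meas, where B=1])
      (intro prob_space.finite_measure prob_space_PiM prob_space_axioms abs_prod_le_1 h_bound)+
  have "src_mu m (quad_indicator ex L) (quad_indicator ey R) two_swaps P
    = (\<integral>w. h w (w 1) (w 2) * h w (w 3) (w 4) \<partial>(\<Pi>\<^sub>M j\<in>{1..m}. P))"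
    unfolding src_mu_def sum ..
  also have "\<dots> = (\<integral>w. (\<integral>z. (\<lambda>w. h w (w 1) (w 2) * h w (w 3) (w 4)) (merge {5..m} ({1, 2} \<union> {3, 4}) (w, z))
      \<partial>(\<Pi>\<^sub>M j\<in>{1, 2} \<union> {3, 4 :: nat}. P)) \<partial>(\<Pi>\<^sub>M j\<in>{5..m}. P))"
    unfolding I using int[unfolded I] by (intro Pi.product_integral_fold) auto
  also have "\<dots> = (\<integral>w. (\<integral>z. h w (z 1) (z 2) * h w (z 3) (z 4) \<partial>(\<Pi>\<^sub>M j\<in>{1, 2} \<union> {3, 4 :: nat}. P)) \<partial>(\<Pi>\<^sub>M j\<in>{5..m}. P))"
  proof -
    have "merge {5..m} ({1, 2} \<union> {3, 4}) (w, z) (ex a) = w (ex a)"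
      "merge {5..m} ({1, 2} \<union> {3, 4}) (w, z) (ey b) = w (ey b)"
      for w z :: "nat \<Rightarrow> (real ^ 'r) \<times> (real ^ 's)" and a b
      using ex[of a] ey[of b] by (simp_all add: merge_def)
    then have h_merge: "h (merge {5..m} ({1, 2} \<union> {3, 4}) (w, z)) = h w" for w z
      by (simp add: h_def fun_eq_iff reference_def)
    show ?thesis unfolding h_merge by (simp add: merge_def)
  qed
  also have "\<dots> = (\<integral>w. (2 * block_minor P L R (?x w) (?y w)) * (2 * block_minor P L R (?x w) (?y w)) \<partial>(\<Pi>\<^sub>M j\<in>{5..m}. P))"
  proof (rule Bochner_Integration.integral_cong[OF refl])
    fix w
    have m: "case_prod (h w) \<in> borel_measurable (P \<Otimes>\<^sub>M P)"
      unfolding h_def case_prod_unfold by (intro borel_measurable_times measurable_skew) simp_all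
    show "(\<integral>z. h w (z 1) (z 2) * h w (z 3) (z 4) \<partial>(\<Pi>\<^sub>M j\<in>{1, 2} \<union> {3, 4 :: nat}. P))
      = (2 * block_minor P L R (?x w) (?y w)) * (2 * block_minor P L R (?x w) (?y w))"
      unfolding integral_PiM_two_pairs[OF prob_space_axioms m m h_bound h_bound]
      by (simp add: h_def[abs_def] integral_skew[OF P fin])
  qed
  finally show ?thesis by (simp add: reference_def power2_eq_square mult.assoc)
qed

section \<open>Reference points drawn from the joint law and from the marginals\<close>

lemma measurable_component_compose:
  assumes "i \<in> I" "f \<in> measurable M N"
  shows "(\<lambda>w. f (w i)) \<in> measurable (\<Pi>\<^sub>M i\<in>I. M) N"
  by (rule measurable_compose[OF measurable_component_singleton[OF assms(1)] assms(2)])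

text \<open>Reading each coordinate from a copy of its own makes the coordinates independent with
  the right marginals. Product measures are determined on boxes, and as \<open>e\<close> is
  injective the preimage of a box is again a box.\<close>

lemma distr_PiM_coordinates:
  fixes e :: "'i::finite \<Rightarrow> 'j" and f :: "'i \<Rightarrow> 'a \<Rightarrow> 'b"
  assumes M: "prob_space M" and e: "inj e" and f: "\<And>i. f i \<in> measurable M N"
  shows "distr (\<Pi>\<^sub>M j\<in>range e. M) (\<Pi>\<^sub>M i\<in>UNIV. distr M N (f i)) (\<lambda>w i. f i (w (e i)))
    = (\<Pi>\<^sub>M i\<in>UNIV. distr M N (f i))"
proof -
  interpret prob_space M by fact
  interpret D: product_prob_space "\<lambda>i. distr M N (f i)" UNIV
    by (rule product_prob_spaceI) (rule prob_space_distr[OF f])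
  interpret K: product_prob_space "\<lambda>_. M" "range e"
    by (rule product_prob_spaceI) (rule M)
  have T: "(\<lambda>w i. f i (w (e i))) \<in> measurable (\<Pi>\<^sub>M j\<in>range e. M) (\<Pi>\<^sub>M i\<in>UNIV. distr M N (f i))"
    by (rule measurable_PiM_single')
      (auto simp: space_PiM dest: PiE_mem intro!: measurable_component_compose f measurable_space[OF f])
  show ?thesis
  proof (rule D.PiM_eqI)
    show "emeasure (distr (\<Pi>\<^sub>M j\<in>range e. M) (\<Pi>\<^sub>M i\<in>UNIV. distr M N (f i)) (\<lambda>w i. f i (w (e i)))) (Pi\<^sub>E UNIV A)
      = (\<Prod>i\<in>UNIV. emeasure (distr M N (f i)) (A i))" if A: "\<And>i. i \<in> UNIV \<Longrightarrow> A i \<in> sets (distr M N (f i))" for A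
    proof -
      \<comment> \<open>The sides are reindexed by copies: copy \<open>j\<close> carries the
        condition on the coordinate that is read from it.\<close>
      let ?B = "\<lambda>j. f (inv' e j) -` A (inv' e j) \<inter> space M"
      have AN: "A i \<in> sets N" for i using A by simp
      have B: "?B j \<in> sets M" for j by (rule measurable_sets[OF f AN])
      have "(\<lambda>w i. f i (w (e i))) -` Pi\<^sub>E UNIV A \<inter> space (\<Pi>\<^sub>M j\<in>range e. M) = Pi\<^sub>E (range e) ?B"
        using e by (auto simp: space_PiM PiE_iff)
      then have "emeasure (distr (\<Pi>\<^sub>M j\<in>range e. M) (\<Pi>\<^sub>M i\<in>UNIV. distr M N (f i)) (\<lambda>w i. f i (w (e i)))) (Pi\<^sub>E UNIV A)
        = emeasure (\<Pi>\<^sub>M j\<in>range e. M) (Pi\<^sub>E (range e) ?B)"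
        using A by (subst emeasure_distr[OF T]) (auto intro!: sets_PiM_I_finite)
      also have "\<dots> = (\<Prod>j\<in>range e. emeasure M (?B j))"
        using B by (intro K.emeasure_PiM) auto
      also have "\<dots> = (\<Prod>i\<in>UNIV. emeasure M (?B (e i)))"
        using e by (simp add: prod.reindex)
      also have "\<dots> = (\<Prod>i\<in>UNIV. emeasure (distr M N (f i)) (A i))"
        using e AN by (simp add: emeasure_distr[OF f])
      finally show ?thesis .
    qed
  qed simp_all
qed

text \<open>Under the joint law the whole reference point is a single draw, so all coordinates are
  read from copy 5. The factor 1/4 cancels the 4 from the two pairs.\<close>

lemma mu_joint_i_src:
  fixes P :: "((real ^ 'r) \<times> (real ^ 's)) measure"
  assumes P: "P \<in> joint_laws" and fin: "finite L" "finite R"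
  shows "mu_joint_i L R P
    = 1 / 4 * src_mu 5 (quad_indicator (\<lambda>_. 5) L) (quad_indicator (\<lambda>_. 5) R) two_swaps P"
proof -
  interpret prob_space P by (rule joint_laws_prob_space[OF P])
  note [measurable_cong] = joint_laws_sets[OF P]
  interpret Pi: product_prob_space "\<lambda>_::nat. P" "{5}"
    by (rule product_prob_spaceI) (rule prob_space_axioms)
  have "(\<lambda>z. (block_minor P L R (fst z) (snd z))\<^sup>2) \<in> borel_measurable P"
    by (intro borel_measurable_power measurable_block_minor P fin) measurable
  from Pi.product_integral_singleton[of _ 5, OF this] show ?thesis
    by (simp add: src_mu_quad_indicator[OF P fin] mu_joint_i_def)
qed

text \<open>Injectivity and disjoint ranges give each of the \<open>r + s\<close> coordinates its
  own copy, so the reference point follows the product of the univariate marginals. Exhausting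
  \<open>{5..m}\<close> leaves no further copies to integrate out.\<close>

lemma mu_prod_i_src:
  fixes P :: "((real ^ 'r) \<times> (real ^ 's)) measure"
  assumes P: "P \<in> joint_laws" and fin: "finite L" "finite R"
    and ex: "inj ex" and ey: "inj ey" and K: "range ex \<inter> range ey = {}" "range ex \<union> range ey = {5..m}"
  shows "mu_prod_i L R P = 1 / 4 * src_mu m (quad_indicator ex L) (quad_indicator ey R) two_swaps P"
proof -
  interpret prob_space P by (rule joint_laws_prob_space[OF P])
  note [measurable_cong] = joint_laws_sets[OF P]
  interpret Pi: product_prob_space "\<lambda>_::nat. P" "{5..m}"
    by (rule product_prob_spaceI) (rule prob_space_axioms)
  let ?X = "\<lambda>w a. fst (w (ex a) :: (real ^ 'r) \<times> (real ^ 's)) $ a" and ?Y = "\<lambda>w b. snd (w (ey b) :: (real ^ 'r) \<times> (real ^ 's)) $ b"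
  let ?M1 = "\<Pi>\<^sub>M a\<in>(UNIV :: 'r set). distr P borel (\<lambda>z. fst z $ a)"
    and ?M2 = "\<Pi>\<^sub>M b\<in>(UNIV :: 's set). distr P borel (\<lambda>z. snd z $ b)"
  define g where "g u v = (block_minor P L R (\<chi> a. u a) (\<chi> b. v b))\<^sup>2" for u v
  have g_bound: "\<bar>g u v\<bar> \<le> 4" for u v
    unfolding g_def by (rule block_minor_square_bounds[OF P fin])
  have coord: "(\<lambda>z. fst z $ a) \<in> borel_measurable P" "(\<lambda>z. snd z $ b) \<in> borel_measurable P" for a :: 'r and b :: 's
    by measurable
  have dX: "distr (\<Pi>\<^sub>M j\<in>range ex. P) ?M1 ?X = ?M1" and dY: "distr (\<Pi>\<^sub>M j\<in>range ey. P) ?M2 ?Y = ?M2"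
    by (rule distr_PiM_coordinates[OF prob_space_axioms ex coord(1)],
        rule distr_PiM_coordinates[OF prob_space_axioms ey coord(2)])
  have X: "?X \<in> measurable (\<Pi>\<^sub>M j\<in>range ex. P) ?M1" and Y: "?Y \<in> measurable (\<Pi>\<^sub>M j\<in>range ey. P) ?M2"
    by (rule measurable_PiM_single'; simp add: measurable_component_compose coord)+
  interpret M1: prob_space ?M1 by (intro prob_space_PiM prob_space_distr coord)
  interpret M2: prob_space ?M2 by (intro prob_space_PiM prob_space_distr coord)
  interpret M12: pair_prob_space ?M1 ?M2 ..
  have g_meas: "case_prod g \<in> borel_measurable (?M1 \<Otimes>\<^sub>M ?M2)"
    unfolding g_def case_prod_unfold
    by (intro borel_measurable_power measurable_block_minor P fin) simp_all
  have comp: "(\<lambda>w. w j) \<in> measurable (\<Pi>\<^sub>M j\<in>{5..m}. P) P" if "j \<in> {5..m}" for j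
    by (rule measurable_component_singleton[OF that])
  have mem: "ex a \<in> {5..m}" "ey b \<in> {5..m}" for a b
    using K(2) by auto
  have "(\<lambda>w. g (?X w) (?Y w)) \<in> borel_measurable (\<Pi>\<^sub>M j\<in>{5..m}. P)"
    unfolding g_def
    by (intro borel_measurable_power measurable_block_minor P fin; subst vec_lambda_beta;
        intro measurable_compose[OF comp[OF mem(1)] coord(1)] measurable_compose[OF comp[OF mem(2)] coord(2)])
  then have int: "integrable (\<Pi>\<^sub>M j\<in>{5..m}. P) (\<lambda>w. g (?X w) (?Y w))"
    by (intro integrable_bounded[where B=4] g_bound prob_space.finite_measure prob_space_PiM prob_space_axioms)
  \<comment> \<open>Fubini separates the copies read by \<open>X\<close> from those read by
    \<open>Y\<close>; each group is then pushed forward to its product of marginals.\<close>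
  have "(\<integral>w. g (?X w) (?Y w) \<partial>(\<Pi>\<^sub>M j\<in>range ex \<union> range ey. P))
    = (\<integral>w. (\<integral>w'. (\<lambda>w. g (?X w) (?Y w)) (merge (range ex) (range ey) (w, w')) \<partial>(\<Pi>\<^sub>M j\<in>range ey. P)) \<partial>(\<Pi>\<^sub>M j\<in>range ex. P))"
    using int K by (intro Pi.product_integral_fold) simp_all
  also have "\<dots> = (\<integral>w. (\<integral>w'. g (?X w) (?Y w') \<partial>(\<Pi>\<^sub>M j\<in>range ey. P)) \<partial>(\<Pi>\<^sub>M j\<in>range ex. P))"
  proof -
    have "merge (range ex) (range ey) (w, w') (ex a) = w (ex a)" "merge (range ex) (range ey) (w, w') (ey b) = w' (ey b)"
      for w w' :: "nat \<Rightarrow> (real ^ 'r) \<times> (real ^ 's)" and a b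
      using K(1) by (auto simp: merge_def)
    then show ?thesis by simp
  qed
  also have "\<dots> = (\<integral>w. (\<integral>v. g (?X w) v \<partial>?M2) \<partial>(\<Pi>\<^sub>M j\<in>range ex. P))"
  proof (rule Bochner_Integration.integral_cong[OF refl])
    fix w assume "w \<in> space (\<Pi>\<^sub>M j\<in>range ex. P)"
    then have "?X w \<in> space ?M1" by (rule measurable_space[OF X])
    then have "g (?X w) \<in> borel_measurable ?M2"
      using measurable_compose[OF measurable_Pair1' g_meas] by simp
    from integral_distr[OF Y this] show "(\<integral>w'. g (?X w) (?Y w') \<partial>(\<Pi>\<^sub>M j\<in>range ey. P)) = (\<integral>v. g (?X w) v \<partial>?M2)"
      by (simp add: dY)
  qed
  also have "\<dots> = (\<integral>u. (\<integral>v. g u v \<partial>?M2) \<partial>?M1)"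
    using integral_distr[OF X M2.borel_measurable_lebesgue_integral[OF g_meas]] by (simp add: dX)
  also have "\<dots> = (\<integral>u. case_prod g u \<partial>(?M1 \<Otimes>\<^sub>M ?M2))"
  proof -
    have "integrable (?M1 \<Otimes>\<^sub>M ?M2) (case_prod g)"
      by (rule integrable_bounded[where B=4]) (use g_meas g_bound M12.finite_measure in auto)
    from M12.integral_fst'[OF this] show ?thesis by simp
  qed
  also have "\<dots> = mu_prod_i L R P"
    by (simp add: mu_prod_i_def g_def case_prod_unfold)
  finally show ?thesis
    using src_mu_quad_indicator[OF P fin mem] by (simp add: g_def K(2))
qed

section \<open>Sums of symmetric rank covariances and consistency\<close>

lemma symmetric_rank_covariance_quarter:
  assumes "\<And>a. ex a \<in> {5..m}" "\<And>b. ey b \<in> {5..m}"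
    and "\<And>P. P \<in> joint_laws \<Longrightarrow> \<mu> P = 1 / 4 * src_mu m (quad_indicator ex L) (quad_indicator ey R) two_swaps P"
  shows "symmetric_rank_covariance \<mu>"
proof -
  have "4 \<le> m" using assms(1)[of undefined] by simp
  moreover have "ex a \<in> {1..m}" "ey b \<in> {1..m}" for a b
    using assms(1)[of a] assms(2)[of b] by simp_all
  ultimately have "rank_indicator m (quad_indicator ex L)" "rank_indicator m (quad_indicator ey R)"
    "balanced_subgroup m two_swaps"
    by (simp_all only: rank_indicator_quad_indicator balanced_two_swaps)
  then show ?thesis
    unfolding symmetric_rank_covariance_def
    using assms(3) zero_less_divide_1_iff[of "4 :: real"] zero_less_numeral by blast
qed

lemma summed_symmetric_rank_covariance_sum:
  fixes k :: nat
  assumes "1 \<le> k" "\<And>i. i \<in> {1..k} \<Longrightarrow> symmetric_rank_covariance (\<nu> i)"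
  shows "summed_symmetric_rank_covariance (\<lambda>P. \<Sum>i=1..k. \<nu> i P)"
  unfolding summed_symmetric_rank_covariance_def
  by (rule exI[of _ k], rule exI[of _ \<nu>]) (use assms in auto)

text \<open>The all-ones vector shows that the set to be partitioned is nonempty, which forces at
  least one rectangle and so a nonempty sum of covariances.\<close>

lemma one_in_bcube: "1 \<in> bcube - {0 :: nat ^ 'd}"
  by (simp add: bcube_def vec_eq_iff)

theorem proposition4p6:
  fixes k :: nat
    and L :: "nat \<Rightarrow> (nat ^ 'r) set"
    and R :: "nat \<Rightarrow> (nat ^ 's) set"
  assumes "\<And>i. i \<in> {1..k} \<Longrightarrow> L i \<noteq> {} \<and> L i \<subseteq> bcube - {0}"
    and "\<And>i. i \<in> {1..k} \<Longrightarrow> R i \<noteq> {} \<and> R i \<subseteq> bcube - {0}"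
    and "disjoint_family_on (\<lambda>i. L i \<times> R i) {1..k}"
    and "(\<Union>i\<in>{1..k}. L i \<times> R i) = (bcube - {0}) \<times> (bcube - {0})"
  shows "summed_symmetric_rank_covariance (mu_joint k L R)
    \<and> summed_symmetric_rank_covariance (mu_prod k L R)
    \<and> (\<forall>\<C>\<subseteq>joint_laws. D_consistent_on \<C> hoeffding_D \<longrightarrow> D_consistent_on \<C> (mu_joint k L R))
    \<and> D_consistent_on joint_laws (mu_prod k L R)"
proof -
  have finL: "finite (L i)" and finR: "finite (R i)" if "i \<in> {1..k}" for i
    using assms(1,2)[OF that] finite_bcube finite_subset[OF _ finite_Diff] by metis+
  have "(1, 1) \<in> (bcube - {0 :: nat ^ 'r}) \<times> (bcube - {0 :: nat ^ 's})"
    using one_in_bcube one_in_bcube by (rule SigmaI)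
  then have k: "1 \<le> k"
    unfolding assms(4)[symmetric] by auto
  let ?r = "CARD('r)" and ?s = "CARD('s)"
  \<comment> \<open>Four copies for the minors and one for each coordinate; \<open>ex\<close> and
    \<open>ey\<close> enumerate consecutive intervals of indices starting at 5.\<close>
  let ?m = "4 + ?r + ?s"
  obtain ex :: "'r \<Rightarrow> nat" where "bij_betw ex UNIV {5..<5 + ?r}"
    using bij_betw_iff_card[of "UNIV :: 'r set" "{5..<5 + ?r}"] by auto
  then have ex: "inj ex" "range ex = {5..<5 + ?r}" by (simp_all add: bij_betw_def)
  obtain ey :: "'s \<Rightarrow> nat" where "bij_betw ey UNIV {5 + ?r..<5 + ?r + ?s}"
    using bij_betw_iff_card[of "UNIV :: 's set" "{5 + ?r..<5 + ?r + ?s}"] by auto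
  then have ey: "inj ey" "range ey = {5 + ?r..<5 + ?r + ?s}" by (simp_all add: bij_betw_def)
  have K: "range ex \<inter> range ey = {}" "range ex \<union> range ey = {5..?m}"
    unfolding ex ey by auto
  have mem: "ex a \<in> {5..?m}" "ey b \<in> {5..?m}" for a b using K(2) by blast+
  have "symmetric_rank_covariance (mu_joint_i (L i) (R i))" if "i \<in> {1..k}" for i
    by (rule symmetric_rank_covariance_quarter[OF _ _ mu_joint_i_src[OF _ finL[OF that] finR[OF that]]]) auto
  then have "summed_symmetric_rank_covariance (mu_joint k L R)"
    using summed_symmetric_rank_covariance_sum[OF k, of "\<lambda>i. mu_joint_i (L i) (R i)"]
    by (simp add: mu_joint_def[abs_def])
  moreover have "symmetric_rank_covariance (mu_prod_i (L i) (R i))" if "i \<in> {1..k}" for i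
    by (rule symmetric_rank_covariance_quarter[OF mem mu_prod_i_src[OF _ finL[OF that] finR[OF that] ex(1) ey(1) K]])
  then have "summed_symmetric_rank_covariance (mu_prod k L R)"
    using summed_symmetric_rank_covariance_sum[OF k, of "\<lambda>i. mu_prod_i (L i) (R i)"]
    by (simp add: mu_prod_def[abs_def])
  \<comment> \<open>The implication from \<open>mu_joint k L R P = 0\<close> to
    \<open>hoeffding_D P = 0\<close> holds law by law, so its contrapositive transfers to any
    class.\<close>
  moreover have "\<forall>\<C>\<subseteq>joint_laws. D_consistent_on \<C> hoeffding_D \<longrightarrow> D_consistent_on \<C> (mu_joint k L R)"
    unfolding D_consistent_on_def
    using mu_joint_zero_imp_hoeffding_D_zero[OF finL finR assms(3,4)] by blast
  moreover have "D_consistent_on joint_laws (mu_prod k L R)"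
    unfolding D_consistent_on_def
    using mu_prod_zero_imp_not_dependent[OF finL finR assms(3,4)] by blast
  ultimately show ?thesis by blast
qed

end
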